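(* For every positive integer $k$ there exist constants $C_k>0$ and $c_k>0$ such that the following holds. Let $S$ be a collection of $n$ closed curves in the plane in general position with at least $\epsilon n^2$ touching pairs, such that each curve in $S$ can be decomposed into $k$ $x$-monotone curves, and suppose $\epsilon>C_k\sqrt{\log\log n/\log n}$. Then $S$ determines at least $c_k\,\epsilon n^2\sqrt{\log n/\log\log n}$ crossing points.
   Context: Closed curves are simple closed (Jordan) curves in the plane. An open curve is $x$-monotone if no two of its points have the same $x$-coordinate; a closed curve can be decomposed into $k$ $x$-monotone curves if it is the union of $k$ $x$-monotone arcs. A family of curves is in general position if no three curves pass through the same point and no two curves share infinitely many points. Two curves touch (form a touching pair) if they have precisely one point in common, at which they do not properly cross; this point is a touching point. All other common points of two curves are crossing points. *)

theory Defs
  imports "HOL-Analysis.Analysis"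
begin

text \<open>The plane is the type \<^typ>\<open>complex\<close> (as in the library's Jordan curve theorem), with
  \<^term>\<open>Re\<close> as the \<open>x\<close>-coordinate. Curves are represented by their point sets.\<close>

definition closed_curve :: "complex set \<Rightarrow> bool" where
  "closed_curve \<gamma> \<longleftrightarrow>
     (\<exists>g. simple_path g \<and> pathfinish g = pathstart g \<and> path_image g = \<gamma>)"

definition x_monotone_arc :: "complex set \<Rightarrow> bool" where
  "x_monotone_arc a \<longleftrightarrow> (\<exists>g. arc g \<and> path_image g = a) \<and> inj_on Re a"

definition x_monotone_decomposable :: "nat \<Rightarrow> complex set \<Rightarrow> bool" where
  "x_monotone_decomposable k \<gamma> \<longleftrightarrow>
     (\<exists>a. (\<forall>i<k. x_monotone_arc (a i)) \<and> \<gamma> = (\<Union>i<k. a i))"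

definition general_position :: "complex set set \<Rightarrow> bool" where
  "general_position S \<longleftrightarrow>
     (\<forall>\<alpha>\<in>S. \<forall>\<beta>\<in>S. \<forall>\<gamma>\<in>S. \<alpha> \<noteq> \<beta> \<and> \<beta> \<noteq> \<gamma> \<and> \<alpha> \<noteq> \<gamma> \<longrightarrow> \<alpha> \<inter> \<beta> \<inter> \<gamma> = {}) \<and>
     (\<forall>\<alpha>\<in>S. \<forall>\<beta>\<in>S. \<alpha> \<noteq> \<beta> \<longrightarrow> finite (\<alpha> \<inter> \<beta>))"

text \<open>The two local sides of a closed curve \<open>\<alpha>\<close> at any of its points are its interior and its
  exterior. Close to an isolated common point \<open>p\<close>, each of the two branches of \<open>\<beta>\<close> leaving \<open>p\<close>
  stays on one side of \<open>\<alpha>\<close>, and the crossing is proper if these sides differ. As the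
  parametrization \<open>g\<close> is existentially quantified, its orientation does not matter, and \<open>p\<close>
  may be assumed not to be its base point.\<close>

definition properly_cross_at :: "complex set \<Rightarrow> complex set \<Rightarrow> complex \<Rightarrow> bool" where
  "properly_cross_at \<alpha> \<beta> p \<longleftrightarrow> p \<in> \<alpha> \<and>
     (\<exists>g t. simple_path g \<and> pathfinish g = pathstart g \<and> path_image g = \<beta> \<and>
        0 < t \<and> t < 1 \<and> g t = p \<and>
        (\<forall>\<^sub>F s in at_left t. g s \<in> inside \<alpha>) \<and>
        (\<forall>\<^sub>F s in at_right t. g s \<in> outside \<alpha>))"

definition touching_point :: "complex set \<Rightarrow> complex set \<Rightarrow> complex \<Rightarrow> bool" where
  "touching_point \<alpha> \<beta> p \<longleftrightarrow> \<alpha> \<inter> \<beta> = {p} \<and> \<not> properly_cross_at \<alpha> \<beta> p"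

definition touch :: "complex set \<Rightarrow> complex set \<Rightarrow> bool" where
  "touch \<alpha> \<beta> \<longleftrightarrow> (\<exists>p. touching_point \<alpha> \<beta> p)"

definition crossing_point :: "complex set \<Rightarrow> complex set \<Rightarrow> complex \<Rightarrow> bool" where
  "crossing_point \<alpha> \<beta> p \<longleftrightarrow> p \<in> \<alpha> \<inter> \<beta> \<and> \<not> touching_point \<alpha> \<beta> p"

definition touching_pairs :: "complex set set \<Rightarrow> complex set set set" where
  "touching_pairs S = {{\<alpha>, \<beta>} | \<alpha> \<beta>. \<alpha> \<in> S \<and> \<beta> \<in> S \<and> \<alpha> \<noteq> \<beta> \<and> touch \<alpha> \<beta>}"

definition crossing_points :: "complex set set \<Rightarrow> complex set" where
  "crossing_points S = {p. \<exists>\<alpha>\<in>S. \<exists>\<beta>\<in>S. \<alpha> \<noteq> \<beta> \<and> crossing_point \<alpha> \<beta> p}"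

end

theory Submission
  imports Defs
begin

text \<open>The curves are split into graphs of functions over intervals. If two curves touch the same
  curve from below at different places, the two curves have to meet between these places; likewise
  from above. So the problem becomes one about a graph whose edges carry times (the abscissae of the
  touchings), where any two edges \<open>uv\<close>, \<open>uw\<close> at a common vertex (a cherry) force a crossing of \<open>v\<close>
  and \<open>w\<close> at a time in between.

  Suppose there are at most \<open>K\<close> times as many crossings as touchings. At scale \<open>l\<close> consider the
  cherries with at most \<open>l\<close> touchings of \<open>u\<close> in between. A vertex pair \<open>v\<close>, \<open>w\<close> with one crossing
  serves on average \<open>l / K\<close> cherries, so by Cauchy-Schwarz many pairs of cherries \<open>(u1; v, w)\<close>,
  \<open>(u2; v, w)\<close> share their crossing. Then \<open>u1\<close> and \<open>u2\<close> cross both to the left and to the right of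
  it, and this yields a constant multiple of \<open>1 / K\<close> times the number of touchings many pairs of
  consecutive crossings of the same two curves whose distance is about \<open>l\<close>. Such pairs belong to only
  one of the scales in a geometric progression with a ratio polynomial in \<open>K\<close>, hence \<open>K\<^sup>2\<close> is at
  least of the order of the number of scales, \<open>log n / log log n\<close>. Distances are measured in numbers
  of touchings along one curve; an edge at which these numbers along its two ends are out of
  proportion forces many crossings, so there are only few of them.\<close>

section \<open>Counting\<close>

text \<open>Write \<open>D\<close> for the number of darts. About \<open>l * D\<close> cherries on
  at most \<open>K * D\<close> crossings leave of order \<open>l^2 * D / K\<close> pairs sharing a
  crossing. A charged gap between consecutive crossings determines \<open>v\<close> and
  \<open>w\<close> up to \<open>O(l^2)\<close> choices, so there are of order \<open>D / K\<close>
  gaps. The obstacle: the two crossings of \<open>u1\<close> and \<open>u2\<close> forced by such a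
  pair need not be consecutive; many closer ones may lie between them. Hence distances are replaced
  by cells of a grid. The forced crossings lie in different fine cells, so some consecutive pair
  between them does too; and cherries near borders of the coarse grid are discarded, so that
  everything happens inside one coarse cell. The coarse grid of one scale is the fine grid of the
  next, which makes the gaps of different scales disjoint. The ratio of order \<open>K^4\<close>
  consists of \<open>K^2\<close> for \<open>l / m\<close>, which keeps the shared crossing away from
  the end of the cherry, and \<open>K^2\<close> for passing from touchings along \<open>u2\<close>
  to \<open>v\<close> or \<open>w\<close> and then to \<open>u1\<close>, at a loss of order
  \<open>K\<close> each time.\<close>

lemma double_count:
  fixes p q :: nat
  assumes "finite U" "finite Y"
    and "\<And>x. x \<in> U \<Longrightarrow> p \<le> card {y\<in>Y. R x y}"
    and "\<And>y. y \<in> Y \<Longrightarrow> card {x\<in>U. R x y} \<le> q"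
  shows "card U * p \<le> card Y * q"
proof -
  have "card U * p \<le> (\<Sum>x\<in>U. card {y\<in>Y. R x y})"
    using sum_mono[of U "\<lambda>_. p"] assms(3) by simp
  also have "\<dots> = (\<Sum>y\<in>Y. card {x\<in>U. R x y})"
    using sum_multicount_gen[OF assms(1,2), of R "\<lambda>y. card {x\<in>U. R x y}"] by simp
  also have "\<dots> \<le> card Y * q"
    using sum_mono[of Y _ "\<lambda>_. q"] assms(4) by simp
  finally show ?thesis .
qed

text \<open>The witness \<open>y\<close> is the first point of \<open>Q\<close> where
  \<open>g\<close> reaches \<open>k\<close>, and \<open>x\<close> is its predecessor in
  \<open>Q\<close>. With \<open>g\<close> a cell number, this finds consecutive crossings in
  different cells between two given crossings.\<close>

lemma consecutive_jump:
  fixes Q :: "'a::linorder set" and g :: "'a \<Rightarrow> nat"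
  assumes "finite Q" "s \<in> Q" "s' \<in> Q" "mono g" "g s < k" "k \<le> g s'"
  obtains x y where "x \<in> Q" "y \<in> Q" "s \<le> x" "x < y" "y \<le> s'" "\<forall>z\<in>Q. z \<le> x \<or> y \<le> z"
    "g x < k" "k \<le> g y"
proof -
  let ?Y = "{z\<in>Q. k \<le> g z}"
  have Y: "finite ?Y" "?Y \<noteq> {}" using assms(1,3,6) by auto
  obtain y where y: "y \<in> Q" "k \<le> g y" "\<And>z. z \<in> Q \<Longrightarrow> k \<le> g z \<Longrightarrow> y \<le> z"
    using Min_in[OF Y] Min_le[OF Y(1)] by blast
  have "s < y"
    using y(2) assms(5) monoD[OF assms(4), of y s] by (meson leD leI order.strict_trans1)
  let ?X = "{z\<in>Q. z < y}"
  have X: "finite ?X" "?X \<noteq> {}" using assms(1,2) \<open>s < y\<close> by auto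
  obtain x where x: "x \<in> Q" "x < y" "\<And>z. z \<in> Q \<Longrightarrow> z < y \<Longrightarrow> z \<le> x"
    using Max_in[OF X] Max_ge[OF X(1)] by blast
  show thesis
  proof
    show "g x < k" using y(3)[OF x(1)] x(2) by (meson leD leI)
    show "\<forall>z\<in>Q. z \<le> x \<or> y \<le> z" using x(3) by force
  qed (use x y \<open>s < y\<close> assms in auto)
qed

text \<open>The \<open>l\<close> smallest elements qualify. The induction removes the maximum, which
  lies in no initial segment but its own.\<close>

lemma card_initial_segment_ge:
  fixes R :: "'a::linorder set"
  assumes "finite R" "l \<le> card R"
  shows "l \<le> card {y\<in>R. card {z\<in>R. z \<le> y} \<le> l}"
  using assms
proof (induction "card R" arbitrary: R)
  case 0
  then show ?case by simp
next
  case (Suc n)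
  show ?case
  proof (cases "l = card R")
    case True
    have "{y\<in>R. card {z\<in>R. z \<le> y} \<le> l} = R"
      using True Suc.prems by (auto intro: card_mono)
    then show ?thesis using True by simp
  next
    case False
    define M where "M = Max R"
    have M: "M \<in> R" "\<And>z. z \<in> R \<Longrightarrow> z \<le> M"
      unfolding M_def using Suc.prems(1) Suc.hyps(2) by (auto intro!: Max_in)
    have "n = card (R - {M})" using Suc.hyps(2) M Suc.prems by simp
    moreover have "l \<le> card (R - {M})"
      using Suc.prems False M by simp
    ultimately have "l \<le> card {y\<in>R-{M}. card {z\<in>R-{M}. z \<le> y} \<le> l}"
      using Suc.hyps(1)[of "R - {M}"] Suc.prems by simp
    also have "\<dots> \<le> card {y\<in>R. card {z\<in>R. z \<le> y} \<le> l}"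
    proof (rule card_mono)
      have "{z\<in>R. z \<le> y} = {z\<in>R-{M}. z \<le> y}" if "y \<in> R - {M}" for y
        using that M by force
      then show "{y\<in>R-{M}. card {z\<in>R-{M}. z \<le> y} \<le> l} \<subseteq> {y\<in>R. card {z\<in>R. z \<le> y} \<le> l}"
        by auto
    qed (use Suc.prems in simp)
    finally show ?thesis .
  qed
qed

lemma card_mod_in_le:
  fixes R :: nat
  assumes "R > 0" "finite M"
  shows "card {i. i \<le> d \<and> i mod R \<in> M} \<le> (d div R + 1) * card M"
proof -
  have "card {i. i \<le> d \<and> i mod R \<in> M} \<le> card ({..d div R} \<times> M)"
  proof (rule card_inj_on_le)
    show "inj_on (\<lambda>i. (i div R, i mod R)) {i. i \<le> d \<and> i mod R \<in> M}"
      by (rule inj_onI) (metis div_mult_mod_eq prod.inject)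
    show "(\<lambda>i. (i div R, i mod R)) ` {i. i \<le> d \<and> i mod R \<in> M} \<subseteq> {..d div R} \<times> M"
      by (auto intro: div_le_mono)
  qed (use assms in simp)
  then show ?thesis by (simp add: card_cartesian_product)
qed

text \<open>The pairs on the right number the sum of the squared fibre sizes; Cauchy-Schwarz
  compares it with the sum of the fibre sizes.\<close>

lemma card_fibre_pairs_ge:
  assumes "finite G" "finite Y" "h ` G \<subseteq> Y"
  shows "(real (card G))\<^sup>2 \<le> real (card Y) * real (card {(x,y). x \<in> G \<and> y \<in> G \<and> h x = h y})"
proof -
  have "card G = (\<Sum>z\<in>Y. card {x\<in>G. h x = z})"
    using sum_card_image card_eq_sum sum.group[OF assms, of "\<lambda>_. 1::nat"] by simp
  then have "(real (card G))\<^sup>2 = (\<Sum>z\<in>Y. real (card {x\<in>G. h x = z}))\<^sup>2" by simp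
  also have "\<dots> \<le> real (card Y) * (\<Sum>z\<in>Y. (real (card {x\<in>G. h x = z}))\<^sup>2)"
    using Cauchy_Schwarz_ineq_sum[of "\<lambda>_. 1" "\<lambda>z. real (card {x\<in>G. h x = z})" Y] by simp
  also have "(\<Sum>z\<in>Y. (real (card {x\<in>G. h x = z}))\<^sup>2) = real (\<Sum>z\<in>Y. card ({x\<in>G. h x = z} \<times> {x\<in>G. h x = z}))"
    by (simp add: card_cartesian_product power2_eq_square)
  also have "(\<Sum>z\<in>Y. card ({x\<in>G. h x = z} \<times> {x\<in>G. h x = z})) =
      card (\<Union>z\<in>Y. {x\<in>G. h x = z} \<times> {x\<in>G. h x = z})"
    by (rule card_UN_disjoint[symmetric]) (use assms in auto)
  also have "(\<Union>z\<in>Y. {x\<in>G. h x = z} \<times> {x\<in>G. h x = z}) = {(x,y). x \<in> G \<and> y \<in> G \<and> h x = h y}"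
    using assms(3) by auto
  finally show ?thesis .
qed

lemma card_doubleton_le: "card {a, b} \<le> 2"
  by (simp add: card_insert_if)

lemma one_le_card: "finite A \<Longrightarrow> a \<in> A \<Longrightarrow> 1 \<le> card A"
  using card_gt_0_iff[of A] by auto

section \<open>Timed touching graphs\<close>

text \<open>Only abscissae are kept of the plane: \<open>f u v\<close> is that of the touching of
  \<open>u\<close> and \<open>v\<close>, and \<open>Q v w\<close> holds those where \<open>v\<close>
  and \<open>w\<close> meet. \<open>f_inj\<close> reflects that no three curves share a point, and
  \<open>sep\<close> that two curves touching \<open>u\<close> from the same side must meet in
  between.\<close>

locale touch_system =
  fixes V :: "'v set" and adj :: "'v \<Rightarrow> 'v \<Rightarrow> bool"
    and f :: "'v \<Rightarrow> 'v \<Rightarrow> real" and Q :: "'v \<Rightarrow> 'v \<Rightarrow> real set"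
  assumes finite_V: "finite V"
    and adj_V: "adj u v \<Longrightarrow> u \<in> V"
    and adj_sym: "adj u v \<Longrightarrow> adj v u"
    and f_sym: "adj u v \<Longrightarrow> f u v = f v u"
    and Q_sym: "Q u v = Q v u"
    and finite_Q: "finite (Q u v)"
    and f_inj: "adj u v \<Longrightarrow> adj u w \<Longrightarrow> f u v = f u w \<Longrightarrow> v = w"
    and sep: "adj u v \<Longrightarrow> adj u w \<Longrightarrow> f u v < f u w \<Longrightarrow> \<exists>s\<in>Q v w. f u v < s \<and> s < f u w"
begin

definition darts :: "('v \<times> 'v) set" where
  "darts = {(u,v). adj u v}"

text \<open>Ordered triples: every meeting is counted from both of its curves, so a charge can
  single out one of them.\<close>

definition crossings :: "('v \<times> 'v \<times> real) set" where
  "crossings = {(u,v,s). u \<in> V \<and> v \<in> V \<and> u \<noteq> v \<and> s \<in> Q u v}"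

definition cnt :: "'v \<Rightarrow> real \<Rightarrow> real \<Rightarrow> nat" where
  "cnt u x y = card {w. adj u w \<and> x \<le> f u w \<and> f u w \<le> y}"

text \<open>The coordinate along \<open>u\<close>, counted in touchings. It is defined at every
  time, so crossings of \<open>u\<close> have a position too, and it is this coordinate that is cut
  into cells.\<close>

definition rank :: "'v \<Rightarrow> real \<Rightarrow> nat" where
  "rank u x = card {w. adj u w \<and> f u w \<le> x}"

lemma adj_V2: "adj u v \<Longrightarrow> v \<in> V"
  using adj_V adj_sym by blast

lemma finite_nbrs [simp]: "finite {w. adj u w \<and> P w}"
  by (rule finite_subset[OF _ finite_V]) (use adj_V2 in auto)

lemma finite_nbrs' [simp]: "finite {w. adj u w}"
  using finite_nbrs[of u "\<lambda>_. True"] by simp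

lemma finite_darts [simp]: "finite darts"
  by (rule finite_subset[of _ "V \<times> V"]) (use adj_V adj_V2 finite_V in \<open>auto simp: darts_def\<close>)

lemma finite_crossings [simp]: "finite crossings"
proof -
  have "crossings \<subseteq> (\<Union>u\<in>V. \<Union>v\<in>V. {u} \<times> {v} \<times> Q u v)"
    by (auto simp: crossings_def)
  then show ?thesis by (rule finite_subset) (use finite_V finite_Q in auto)
qed

lemma cnt_mono: "x' \<le> x \<Longrightarrow> y \<le> y' \<Longrightarrow> cnt u x y \<le> cnt u x' y'"
  unfolding cnt_def by (rule card_mono) auto

lemma rank_mono: "mono (rank u)"
  unfolding rank_def by (intro monoI card_mono) auto

lemma rank_le_add_cnt: "rank u y \<le> rank u x + cnt u x y"
proof -
  have "rank u y \<le> card ({w. adj u w \<and> f u w \<le> x} \<union> {w. adj u w \<and> x \<le> f u w \<and> f u w \<le> y})"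
    unfolding rank_def by (rule card_mono) auto
  also have "\<dots> \<le> rank u x + cnt u x y"
    unfolding rank_def cnt_def by (rule card_Un_le)
  finally show ?thesis .
qed

lemma rank_add_cnt_le: "s < x \<Longrightarrow> rank u s + cnt u x y \<le> rank u (max s y)"
proof -
  assume "s < x"
  then have "rank u s + cnt u x y = card ({w. adj u w \<and> f u w \<le> s} \<union> {w. adj u w \<and> x \<le> f u w \<and> f u w \<le> y})"
    unfolding rank_def cnt_def by (subst card_Un_disjoint) auto
  also have "\<dots> \<le> rank u (max s y)"
    unfolding rank_def by (rule card_mono) auto
  finally show ?thesis .
qed

lemma rank_inj:
  assumes "adj u v" "adj u w" "rank u (f u v) = rank u (f u w)"
  shows "v = w"
proof -
  have *: "rank u (f u v) < rank u (f u w)" if "f u v < f u w" "adj u w" for v w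
    unfolding rank_def
  proof (rule psubset_card_mono)
    have "w \<in> {z. adj u z \<and> f u z \<le> f u w}" "w \<notin> {z. adj u z \<and> f u z \<le> f u v}"
      using that by auto
    moreover have "{z. adj u z \<and> f u z \<le> f u v} \<subseteq> {z. adj u z \<and> f u z \<le> f u w}"
      using that by auto
    ultimately show "{z. adj u z \<and> f u z \<le> f u v} \<subset> {z. adj u z \<and> f u z \<le> f u w}"
      by blast
  qed simp
  show ?thesis
    using *[of v w] *[of w v] f_inj[OF assms(1,2)] assms by (cases "f u v" "f u w" rule: linorder_cases) auto
qed

lemma card_rank_in: "finite M \<Longrightarrow> card {v. adj u v \<and> rank u (f u v) \<in> M} \<le> card M"
  by (rule card_inj_on_le[where f = "\<lambda>v. rank u (f u v)"]) (auto intro: inj_onI rank_inj)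

text \<open>The earliest such \<open>d\<close> has all the others between itself and
  \<open>s\<close>, and there are at most \<open>m\<close> touchings there. This limits how many
  darts can charge one crossing.\<close>

lemma few_before: "card {d. adj c d \<and> f c d \<le> s \<and> cnt c (f c d) s \<le> m} \<le> m"
proof (cases "{d. adj c d \<and> f c d \<le> s \<and> cnt c (f c d) s \<le> m} = {}")
  case False
  let ?D = "{d. adj c d \<and> f c d \<le> s \<and> cnt c (f c d) s \<le> m}"
  obtain d0 where d0: "d0 \<in> ?D" "\<And>d. d \<in> ?D \<Longrightarrow> f c d0 \<le> f c d"
    using arg_min_if_finite(1)[OF finite_nbrs False, of "f c"] arg_min_least[OF finite_nbrs False, of _ "f c"]
    by blast
  have "card ?D \<le> cnt c (f c d0) s"
    unfolding cnt_def[of _ "f c d0"] by (rule card_mono) (use d0 in auto)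
  then show ?thesis using d0(1) by auto
qed (simp only: card.empty)

text \<open>The darts \<open>(c, d)\<close> that are unbalanced to the right: shortly after touching \<open>c\<close>, the curve \<open>d\<close>
  has more than \<open>B\<close> times as many touchings as \<open>c\<close>. Each of them costs a crossing of \<open>c\<close>.\<close>

definition unbR :: "nat \<Rightarrow> nat \<Rightarrow> ('v \<times> 'v) set" where
  "unbR B m = {(c,d). adj c d \<and> (\<exists>e. adj c e \<and> f c d < f c e \<and>
      cnt c (f c d) (f c e) \<le> m \<and> B * m < cnt d (f c d) (f c e))}"

definition unbL :: "nat \<Rightarrow> nat \<Rightarrow> ('v \<times> 'v) set" where
  "unbL B m = {(c,d). adj c d \<and> (\<exists>e. adj c e \<and> f c e < f c d \<and>
      cnt c (f c e) (f c d) \<le> m \<and> B * m < cnt d (f c e) (f c d))}"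

lemma not_unbRD:
  "(c,d) \<notin> unbR B m \<Longrightarrow> adj c d \<Longrightarrow> adj c e \<Longrightarrow> f c d < f c e \<Longrightarrow> cnt c (f c d) (f c e) \<le> m \<Longrightarrow>
    cnt d (f c d) (f c e) \<le> B * m"
  by (auto simp: unbR_def not_less)

lemma not_unbLD:
  "(c,d) \<notin> unbL B m \<Longrightarrow> adj c d \<Longrightarrow> adj c e \<Longrightarrow> f c e < f c d \<Longrightarrow> cnt c (f c e) (f c d) \<le> m \<Longrightarrow>
    cnt d (f c e) (f c d) \<le> B * m"
  by (auto simp: unbL_def not_less)

text \<open>Each touching of \<open>d\<close> with some \<open>z\<close> other than \<open>c\<close>
  in the window forces, by \<open>sep\<close> at \<open>d\<close>, a crossing of \<open>c\<close>
  and \<open>z\<close> in the window. As \<open>c\<close> has at most \<open>m\<close> touchings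
  there, \<open>few_before\<close> lets at most \<open>m\<close> darts charge the same
  crossing.\<close>

lemma card_unbR:
  assumes "m > 0"
  shows "card (unbR B m) * B \<le> card crossings"
proof -
  define Rl where "Rl = (\<lambda>(c,d) (c',z::'v,s). c' = c \<and> f c d \<le> s \<and> cnt c (f c d) s \<le> m)"
  have "card (unbR B m) * (B * m) \<le> card crossings * m"
  proof (rule double_count[where R = Rl])
    show "finite (unbR B m)"
      by (rule finite_subset[OF _ finite_darts]) (auto simp: unbR_def darts_def)
  next
    fix p assume "p \<in> unbR B m"
    then obtain c d e where p: "p = (c,d)" "adj c d" "adj c e" "f c d < f c e"
      "cnt c (f c d) (f c e) \<le> m" "B * m < cnt d (f c d) (f c e)"
      by (auto simp: unbR_def)
    \<comment> \<open>The touching with \<open>c\<close> itself is dropped; the strict inequality in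
      \<open>unbR\<close> pays for it.\<close>
    define Z where "Z = {z. adj d z \<and> f c d \<le> f d z \<and> f d z \<le> f c e} - {c}"
    have "B * m \<le> card Z"
      using p(6) diff_card_le_card_Diff[of "{c}" "{z. adj d z \<and> f c d \<le> f d z \<and> f d z \<le> f c e}"]
      unfolding Z_def cnt_def by simp
    have dc: "adj d c" "f d c = f c d" using p adj_sym f_sym by metis+
    have ex: "\<exists>s\<in>Q c z. f c d < s \<and> s < f d z" if "z \<in> Z" for z
    proof -
      have "f d c \<noteq> f d z" using f_inj[of d c z] dc that by (auto simp: Z_def)
      then show ?thesis using sep[of d c z] dc that by (auto simp: Z_def)
    qed
    then obtain S where S: "\<And>z. z \<in> Z \<Longrightarrow> S z \<in> Q c z \<and> f c d < S z \<and> S z < f d z"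
      by metis
    have "card Z \<le> card {y\<in>crossings. Rl p y}"
    proof (rule card_inj_on_le[where f = "\<lambda>z. (c, z, S z)"])
      show "(\<lambda>z. (c, z, S z)) ` Z \<subseteq> {y\<in>crossings. Rl p y}"
      proof clarify
        fix z assume z: "z \<in> Z"
        then have "cnt c (f c d) (S z) \<le> cnt c (f c d) (f c e)"
          using S[OF z] by (intro cnt_mono) (auto simp: Z_def)
        then show "(c, z, S z) \<in> crossings \<and> Rl p (c, z, S z)"
          using S[OF z] z p adj_V adj_V2 by (auto simp: crossings_def Rl_def Z_def)
      qed
    qed (auto intro: inj_onI)
    with \<open>B * m \<le> card Z\<close> show "B * m \<le> card {y\<in>crossings. Rl p y}" by simp
  next
    fix y assume "y \<in> crossings"
    obtain c z s where y: "y = (c,z,s)" by (cases y)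
    have "card {x\<in>unbR B m. Rl x y} \<le> card {d. adj c d \<and> f c d \<le> s \<and> cnt c (f c d) s \<le> m}"
      by (rule card_inj_on_le[where f = snd]) (auto intro!: inj_onI simp: Rl_def y unbR_def)
    also have "\<dots> \<le> m" by (rule few_before)
    finally show "card {x\<in>unbR B m. Rl x y} \<le> m" .
  qed simp
  then show ?thesis using assms by (simp add: mult.assoc[symmetric])
qed

text \<open>Reflection in a vertical line, which exchanges \<open>unbR\<close> with
  \<open>unbL\<close> and earlier with later touchings.\<close>

lemma reversed: "touch_system V adj (\<lambda>u v. - f u v) (\<lambda>u v. uminus ` Q u v)"
proof
  fix u v w assume a: "adj u v" "adj u w" "- f u v < - f u w"
  then obtain s where "s \<in> Q w v" "f u w < s" "s < f u v"
    using sep[of u w v] by auto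
  then show "\<exists>s\<in>uminus ` Q v w. - f u v < s \<and> s < - f u w"
    by (intro bexI[of _ "-s"]) (auto simp: Q_sym[of v w])
qed (use finite_V adj_V adj_sym f_sym Q_sym finite_Q f_inj in auto)

lemma cnt_reversed: "touch_system.cnt adj (\<lambda>u v. - f u v) u x y = cnt u (- y) (- x)"
  unfolding cnt_def touch_system.cnt_def[OF reversed]
  by (rule arg_cong[where f = card]) auto

lemma card_crossings_reversed:
  "card (touch_system.crossings V (\<lambda>u v. uminus ` Q u v)) = card crossings"
  unfolding crossings_def touch_system.crossings_def[OF reversed]
  by (rule bij_betw_same_card[where f = "\<lambda>(u,v,s). (u,v,-s)"], rule bij_betwI[where g = "\<lambda>(u,v,s). (u,v,-s)"]) auto

lemma few_after: "card {d. adj c d \<and> s \<le> f c d \<and> cnt c s (f c d) \<le> m} \<le> m"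
  using touch_system.few_before[OF reversed, of c "-s" m] by (simp add: cnt_reversed)

lemma card_unbL:
  assumes "m > 0"
  shows "card (unbL B m) * B \<le> card crossings"
  using touch_system.card_unbR[OF reversed assms, of B]
  unfolding touch_system.unbR_def[OF reversed] unbL_def by (simp add: cnt_reversed card_crossings_reversed)

text \<open>Consecutive crossings \<open>x < y\<close> of \<open>u1\<close> and \<open>u2\<close>, represented by \<open>y\<close>, whose distance along \<open>u1\<close>
  is of an order between \<open>m\<close> and \<open>R\<close>, in the sense of the grids of mesh \<open>m\<close> and \<open>R\<close>.\<close>

definition targets :: "nat \<Rightarrow> nat \<Rightarrow> ('v \<times> 'v \<times> real) set" where
  "targets m R = {(u1,u2,y). (u1,u2,y) \<in> crossings \<and> (\<exists>x\<in>Q u1 u2. x < y \<and> (\<forall>z\<in>Q u1 u2. z \<le> x \<or> y \<le> z) \<and>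
     rank u1 x div m \<noteq> rank u1 y div m \<and> rank u1 x div R = rank u1 y div R)}"

lemma finite_targets [simp]: "finite (targets m R)"
  by (rule finite_subset[OF _ finite_crossings]) (auto simp: targets_def)

lemma finite_unb [simp]: "finite (unbR B m)" "finite (unbL B m)"
  by (rule finite_subset[OF _ finite_darts]; auto simp: unbR_def unbL_def darts_def)+

text \<open>The grids of mesh \<open>r ^ i\<close> are nested, so positions in one cell of mesh
  \<open>r ^ Suc i\<close> share a cell of every coarser grid. Hence a gap is a target on at most
  one scale.\<close>

lemma sum_card_targets_le:
  "(\<Sum>i<h. card (targets (r ^ i) (r ^ Suc i))) \<le> card crossings"
proof -
  have disj: "targets (r ^ i) (r ^ Suc i) \<inter> targets (r ^ j) (r ^ Suc j) = {}" if "i < j" for i j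
  proof (rule ccontr)
    assume "targets (r ^ i) (r ^ Suc i) \<inter> targets (r ^ j) (r ^ Suc j) \<noteq> {}"
    then obtain u1 u2 y x x' where xy: "x \<in> Q u1 u2" "x < y" "\<forall>z\<in>Q u1 u2. z \<le> x \<or> y \<le> z"
      "rank u1 x div r ^ Suc i = rank u1 y div r ^ Suc i"
      and xy': "x' \<in> Q u1 u2" "x' < y" "\<forall>z\<in>Q u1 u2. z \<le> x' \<or> y \<le> z"
      "rank u1 x' div r ^ j \<noteq> rank u1 y div r ^ j"
      unfolding targets_def by blast
    \<comment> \<open>A target records only the right end of the gap, which determines the left
      end.\<close>
    have "x' = x" using xy xy' by (meson antisym leD)
    have "r ^ j = r ^ Suc i * r ^ (j - Suc i)"
      using that by (simp flip: power_add power_Suc)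
    then have "rank u1 x div r ^ j = rank u1 y div r ^ j"
      using xy(4) by (simp only: div_mult2_eq)
    then show False using xy'(4) \<open>x' = x\<close> by simp
  qed
  have "(\<Sum>i<h. card (targets (r ^ i) (r ^ Suc i))) = card (\<Union>i<h. targets (r ^ i) (r ^ Suc i))"
  proof (rule card_UN_disjoint[symmetric])
    show "\<forall>i\<in>{..<h}. \<forall>j\<in>{..<h}. i \<noteq> j \<longrightarrow> targets (r ^ i) (r ^ Suc i) \<inter> targets (r ^ j) (r ^ Suc j) = {}"
      using disj by (metis Int_commute linorder_neqE_nat)
  qed auto
  also have "\<dots> \<le> card crossings"
    by (rule card_mono) (auto simp: targets_def)
  finally show ?thesis .
qed

end

section \<open>A single scale\<close>

locale touch_scale = touch_system +
  fixes B l m R :: nat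
  assumes B_pos: "0 < B" and m_pos: "0 < m" and m_le_l: "m \<le> l" and R_pos: "0 < R"
begin

text \<open>At most \<open>l\<close> touchings along one curve become at most \<open>B * l\<close>
  along a balanced neighbour, and at most \<open>W\<close> along a balanced neighbour of that
  one.\<close>

definition W :: nat where
  "W = B * (B * l)"

text \<open>Fixing one crossing per cherry gives every cherry a single key for
  Cauchy-Schwarz.\<close>

definition phi :: "'a \<Rightarrow> 'a \<Rightarrow> 'a \<Rightarrow> real" where
  "phi u v w = (SOME s. s \<in> Q v w \<and> f u v < s \<and> s < f u w)"

definition cherries :: "('a \<times> 'a \<times> 'a) set" where
  "cherries = {(u,v,w). adj u v \<and> adj u w \<and> f u v < f u w \<and> cnt u (f u v) (f u w) \<le> l}"

text \<open>The margins match the reach of the crossings forced by a twin: up to \<open>W\<close>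
  below the rank of the touching with \<open>v\<close>, and up to \<open>l + W\<close> above
  it.\<close>

definition off_boundary :: "'a \<Rightarrow> 'a \<Rightarrow> bool" where
  "off_boundary u v \<longleftrightarrow> W \<le> rank u (f u v) mod R \<and> rank u (f u v) mod R + W + l < R"

text \<open>In a twin, the conditions on \<open>(u,v)\<close> and \<open>(u,w)\<close> at
  \<open>l\<close> are used for \<open>u2\<close> and those at \<open>B * l\<close> for
  \<open>u1\<close>; a cherry may play either role. The lower bound on \<open>cnt\<close> puts more
  than a fine cell between the crossing and \<open>w\<close>; the condition at \<open>m + 1\<close>
  serves to count the cherries violating this bound.\<close>

definition good :: "('a \<times> 'a \<times> 'a) set" where
  "good = {(u,v,w). (u,v,w) \<in> cherries \<and>
     (u,v) \<notin> unbR B l \<and> (v,u) \<notin> unbL B (B * l) \<and>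
     (u,w) \<notin> unbL B l \<and> (w,u) \<notin> unbR B (B * l) \<and> (u,w) \<notin> unbL B (m + 1) \<and>
     m < cnt u (phi u v w) (f u w) \<and> off_boundary u v}"

text \<open>\<open>u1\<close> is the curve that touches \<open>w\<close> first, so the crossing of
  \<open>u1\<close> and \<open>u2\<close> forced at \<open>w\<close> comes after the touching of
  \<open>u1\<close> with \<open>w\<close>.\<close>

definition twins :: "('a \<times> 'a \<times> 'a \<times> 'a) set" where
  "twins = {(u1,u2,v,w). (u1,v,w) \<in> good \<and> (u2,v,w) \<in> good \<and> phi u1 v w = phi u2 v w \<and> f u1 w < f u2 w}"

lemma l_pos: "0 < l"
  using m_pos m_le_l by simp

lemma phi:
  assumes "adj u v" "adj u w" "f u v < f u w"
  shows "phi u v w \<in> Q v w" "f u v < phi u v w" "phi u v w < f u w"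
  using someI_ex[of "\<lambda>s. s \<in> Q v w \<and> f u v < s \<and> s < f u w"] sep[OF assms]
  by (auto simp: phi_def)

lemma finite_cherries [simp]: "finite cherries"
  by (rule finite_subset[of _ "V \<times> V \<times> V"]) (use adj_V adj_V2 finite_V in \<open>auto simp: cherries_def\<close>)

lemma card_darts: "card darts = (\<Sum>u\<in>V. card {v. adj u v})"
proof -
  have "darts = (SIGMA u:V. {v. adj u v})" using adj_V by (auto simp: darts_def)
  then show ?thesis using finite_V by (simp add: card_SigmaI)
qed

text \<open>At each vertex all but at most \<open>l\<close> touchings have at least \<open>l\<close>
  later ones. The next \<open>l - 1\<close> of these complete a cherry each; one is lost because
  \<open>cnt\<close> includes \<open>v\<close> itself.\<close>

lemma card_cherries_ge: "card darts * (l - 1) \<le> card cherries + card V * l * l"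
proof -
  define poor where "poor = {(u,v). adj u v \<and> card {w. adj u w \<and> f u v < f u w} < l}"
  have poor_sub: "poor \<subseteq> darts" by (auto simp: poor_def darts_def)
  have "card poor * 1 \<le> card V * l"
  proof (rule double_count[where R = "\<lambda>p u. u = fst p"])
    show "finite poor" using poor_sub finite_darts finite_subset by blast
    show "1 \<le> card {y \<in> V. y = fst x}" if "x \<in> poor" for x
    proof -
      have "{y \<in> V. y = fst x} = {fst x}" using that adj_V by (auto simp: poor_def)
      then show ?thesis by simp
    qed
    fix u
    \<comment> \<open>Any upper bound for the times at \<open>u\<close> serves; \<open>0\<close>
      keeps the set nonempty if \<open>u\<close> has no neighbours.\<close>
    define s where "s = Max (insert 0 (f u ` {w. adj u w}))"
    have s: "f u w \<le> s" if "adj u w" for w using that by (simp add: s_def)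
    have "card {x \<in> poor. u = fst x} \<le> card {d. adj u d \<and> f u d \<le> s \<and> cnt u (f u d) s \<le> l}"
    proof (rule card_inj_on_le[where f = snd])
      show "snd ` {x \<in> poor. u = fst x} \<subseteq> {d. adj u d \<and> f u d \<le> s \<and> cnt u (f u d) s \<le> l}"
      proof
        fix d assume "d \<in> snd ` {x \<in> poor. u = fst x}"
        then have d: "adj u d" "card {w. adj u w \<and> f u d < f u w} < l" by (auto simp: poor_def)
        have "cnt u (f u d) s \<le> card (insert d {w. adj u w \<and> f u d < f u w})"
          unfolding cnt_def using f_inj[OF d(1)] by (intro card_mono) force+
        also have "\<dots> \<le> l" using d(2) card_insert_le_m1[of l] by (simp add: card_insert_if)
        finally show "d \<in> {d. adj u d \<and> f u d \<le> s \<and> cnt u (f u d) s \<le> l}"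
          using d s by simp
      qed
    qed (auto intro: inj_onI)
    also have "\<dots> \<le> l" by (rule few_before)
    finally show "card {x \<in> poor. u = fst x} \<le> l" .
  qed (rule finite_V)
  moreover have "card (darts - poor) * (l - 1) \<le> card cherries * 1"
  proof (rule double_count[where R = "\<lambda>p c. p = (fst c, fst (snd c))"])
    fix p assume "p \<in> darts - poor"
    then obtain u v where p: "p = (u,v)" "adj u v" "l \<le> card {w. adj u w \<and> f u v < f u w}"
      by (fastforce simp: darts_def poor_def)
    define S where "S = f u ` {w. adj u w \<and> f u v < f u w}"
    have inj: "inj_on (f u) {w. adj u w \<and> f u v < f u w}" using f_inj by (auto intro!: inj_onI)
    then have "card S = card {w. adj u w \<and> f u v < f u w}" by (simp add: S_def card_image)
    then have "l - 1 \<le> card {y\<in>S. card {z\<in>S. z \<le> y} \<le> l - 1}"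
      using p(3) by (intro card_initial_segment_ge) (auto simp: S_def)
    also have "\<dots> \<le> card {w. (u,v,w) \<in> cherries}"
    proof (rule surj_card_le)
      show "finite {w. (u,v,w) \<in> cherries}" by (simp add: cherries_def)
      show "{y\<in>S. card {z\<in>S. z \<le> y} \<le> l - 1} \<subseteq> f u ` {w. (u,v,w) \<in> cherries}"
      proof clarify
        fix y assume y: "y \<in> S" "card {z\<in>S. z \<le> y} \<le> l - 1"
        then obtain w where w: "adj u w" "f u v < f u w" "y = f u w" by (auto simp: S_def)
        have "cnt u (f u v) (f u w) \<le> card (insert v {z. adj u z \<and> f u v < f u z \<and> f u z \<le> f u w})"
          unfolding cnt_def using f_inj[OF p(2)] by (intro card_mono) force+
        also have "\<dots> \<le> 1 + card {z. adj u z \<and> f u v < f u z \<and> f u z \<le> f u w}"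
          by (simp add: card_insert_if)
        also have "card {z. adj u z \<and> f u v < f u z \<and> f u z \<le> f u w} \<le> card {z\<in>S. z \<le> y}"
          by (rule card_inj_on_le[of "f u"]) (use f_inj w in \<open>auto intro!: inj_onI simp: S_def\<close>)
        finally have "cnt u (f u v) (f u w) \<le> l" using y(2) l_pos by linarith
        then show "y \<in> f u ` {w. (u,v,w) \<in> cherries}"
          using w p(2) by (auto simp: cherries_def)
      qed
    qed
    also have "\<dots> \<le> card {y \<in> cherries. p = (fst y, fst (snd y))}"
      by (rule card_inj_on_le[where f = "\<lambda>w. (u,v,w)"]) (auto intro: inj_onI simp: p)
    finally show "l - 1 \<le> card {y \<in> cherries. p = (fst y, fst (snd y))}" .
  next
    fix c assume "c \<in> cherries"
    have "{x \<in> darts - poor. x = (fst c, fst (snd c))} \<subseteq> {(fst c, fst (snd c))}" by auto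
    then have "card {x \<in> darts - poor. x = (fst c, fst (snd c))} \<le> card {(fst c, fst (snd c))}"
      by (intro card_mono) auto
    then show "card {x \<in> darts - poor. x = (fst c, fst (snd c))} \<le> 1" by simp
  qed auto
  moreover have "card (darts - poor) = card darts - card poor"
    using poor_sub finite_darts by (simp add: card_Diff_subset finite_subset)
  moreover have "card poor \<le> card darts" using poor_sub by (simp add: card_mono)
  moreover have "card poor * (l - 1) \<le> card V * l * l"
    using \<open>card poor * 1 \<le> card V * l\<close> by (intro mult_le_mono) auto
  ultimately show ?thesis by (simp add: diff_mult_distrib)
qed

lemma card_cherries_first:
  assumes "finite P"
  shows "card {(u,v,w). (u,v,w) \<in> cherries \<and> (u,v) \<in> P} \<le> card P * l"
proof -
  have "card {(u,v,w). (u,v,w) \<in> cherries \<and> (u,v) \<in> P} * 1 \<le> card P * l"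
  proof (rule double_count[where R = "\<lambda>c p. p = (fst c, fst (snd c))"])
    show "finite {(u,v,w). (u,v,w) \<in> cherries \<and> (u,v) \<in> P}"
      by (rule finite_subset[OF _ finite_cherries]) auto
    fix c assume "c \<in> {(u,v,w). (u,v,w) \<in> cherries \<and> (u,v) \<in> P}"
    then have "{p\<in>P. p = (fst c, fst (snd c))} = {(fst c, fst (snd c))}" by auto
    then show "1 \<le> card {p\<in>P. p = (fst c, fst (snd c))}" by simp
  next
    fix p :: "'a \<times> 'a"
    obtain u v where p: "p = (u,v)" by (cases p)
    have "card {c \<in> {(u,v,w). (u,v,w) \<in> cherries \<and> (u,v) \<in> P}. p = (fst c, fst (snd c))}
      \<le> card {w. adj u w \<and> f u v \<le> f u w \<and> cnt u (f u v) (f u w) \<le> l}"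
      by (rule card_inj_on_le[where f = "\<lambda>(u,v,w). w"]) (auto intro!: inj_onI simp: p cherries_def)
    also have "\<dots> \<le> l" by (rule few_after)
    finally show "card {c \<in> {(u,v,w). (u,v,w) \<in> cherries \<and> (u,v) \<in> P}. p = (fst c, fst (snd c))} \<le> l" .
  qed (rule assms)
  then show ?thesis by simp
qed

lemma card_cherries_second:
  assumes "finite P"
  shows "card {(u,v,w). (u,v,w) \<in> cherries \<and> (u,w) \<in> P} \<le> card P * l"
proof -
  have "card {(u,v,w). (u,v,w) \<in> cherries \<and> (u,w) \<in> P} * 1 \<le> card P * l"
  proof (rule double_count[where R = "\<lambda>c p. p = (fst c, snd (snd c))"])
    show "finite {(u,v,w). (u,v,w) \<in> cherries \<and> (u,w) \<in> P}"
      by (rule finite_subset[OF _ finite_cherries]) auto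
    fix c assume "c \<in> {(u,v,w). (u,v,w) \<in> cherries \<and> (u,w) \<in> P}"
    then have "{p\<in>P. p = (fst c, snd (snd c))} = {(fst c, snd (snd c))}" by auto
    then show "1 \<le> card {p\<in>P. p = (fst c, snd (snd c))}" by simp
  next
    fix p :: "'a \<times> 'a"
    obtain u w where p: "p = (u,w)" by (cases p)
    have "card {c \<in> {(u,v,w). (u,v,w) \<in> cherries \<and> (u,w) \<in> P}. p = (fst c, snd (snd c))}
      \<le> card {v. adj u v \<and> f u v \<le> f u w \<and> cnt u (f u v) (f u w) \<le> l}"
      by (rule card_inj_on_le[where f = "\<lambda>(u,v,w). v"]) (auto intro!: inj_onI simp: p cherries_def)
    also have "\<dots> \<le> l" by (rule few_before)
    finally show "card {c \<in> {(u,v,w). (u,v,w) \<in> cherries \<and> (u,w) \<in> P}. p = (fst c, snd (snd c))} \<le> l" .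
  qed (rule assms)
  then show ?thesis by simp
qed

text \<open>Such a cherry is charged to its crossing, seen from \<open>w\<close>. Few touchings of
  \<open>u\<close> between the crossing and \<open>w\<close> mean, by balance, few touchings of
  \<open>w\<close> there, so \<open>u\<close> is among the first \<open>B * (m + 1)\<close>
  touchings of \<open>w\<close> after the crossing.\<close>

lemma card_noncentral:
  "card {(u,v,w). (u,v,w) \<in> cherries \<and> (u,w) \<notin> unbL B (m + 1) \<and> cnt u (phi u v w) (f u w) \<le> m}
    \<le> card crossings * (B * (m + 1))" (is "card ?C \<le> _")
proof -
  have key: "(w, v, phi u v w) \<in> crossings \<and> adj w u \<and> phi u v w \<le> f w u \<and>
      cnt w (phi u v w) (f w u) \<le> B * (m + 1)" if "(u,v,w) \<in> ?C" for u v w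
  proof -
    from that have c: "adj u v" "adj u w" "f u v < f u w" "(u,w) \<notin> unbL B (m + 1)"
      "cnt u (phi u v w) (f u w) \<le> m" by (auto simp: cherries_def)
    note ph = phi[OF c(1-3)]
    \<comment> \<open>Windows in \<open>unbL\<close> start at a touching, so the window is extended
      back to the last touching \<open>e\<close> of \<open>u\<close> before the crossing. This one
      extra touching is the reason for \<open>m + 1\<close>.\<close>
    let ?S = "{e. adj u e \<and> f u e < phi u v w}"
    have "?S \<noteq> {}" using c ph by auto
    then have "Max (f u ` ?S) \<in> f u ` ?S" by (intro Max_in) auto
    then obtain e where e: "adj u e" "f u e < phi u v w" "f u e = Max (f u ` ?S)" by auto
    have e_max: "f u z \<le> f u e" if "adj u z" "f u z < phi u v w" for z
      unfolding e(3) using that by (intro Max_ge) auto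
    have "cnt u (f u e) (f u w) \<le> card (insert e {z. adj u z \<and> phi u v w \<le> f u z \<and> f u z \<le> f u w})"
      unfolding cnt_def
    proof (rule card_mono)
      show "{z. adj u z \<and> f u e \<le> f u z \<and> f u z \<le> f u w} \<subseteq>
          insert e {z. adj u z \<and> phi u v w \<le> f u z \<and> f u z \<le> f u w}"
        using e_max f_inj[OF e(1)] by force
    qed simp
    also have "\<dots> \<le> m + 1" using c(5) by (simp add: card_insert_if cnt_def)
    finally have "cnt u (f u e) (f u w) \<le> m + 1" .
    moreover have "f u e < f u w" using e ph by simp
    ultimately have "cnt w (f u e) (f u w) \<le> B * (m + 1)"
      using c(2,4) e(1) by (auto simp: unbL_def not_less)
    moreover have "cnt w (phi u v w) (f u w) \<le> cnt w (f u e) (f u w)"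
      using e(2) by (intro cnt_mono) auto
    moreover have "v \<noteq> w" using c by auto
    ultimately show ?thesis
      using ph adj_sym[OF c(2)] f_sym[OF c(2)] adj_V2 c by (auto simp: crossings_def Q_sym[of w v])
  qed
  have "card ?C * 1 \<le> card crossings * (B * (m + 1))"
  proof (rule double_count[where R = "\<lambda>(u,v,w) y. y = (w,v,phi u v w)"])
    show "finite ?C" by (rule finite_subset[OF _ finite_cherries]) auto
    fix c assume c: "c \<in> ?C"
    obtain u v w where cc: "c = (u,v,w)" by (cases c)
    have "{y\<in>crossings. (\<lambda>(u,v,w) y. y = (w,v,phi u v w)) c y} = {(w,v,phi u v w)}"
      using key[of u v w] c cc by auto
    then show "1 \<le> card {y\<in>crossings. (\<lambda>(u,v,w) y. y = (w,v,phi u v w)) c y}" by simp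
  next
    fix y :: "'a \<times> 'a \<times> real"
    obtain w v s where y: "y = (w,v,s)" by (cases y)
    have "card {c\<in>?C. (\<lambda>(u,v,w) y. y = (w,v,phi u v w)) c y}
        \<le> card {u. adj w u \<and> s \<le> f w u \<and> cnt w s (f w u) \<le> B * (m + 1)}"
    proof (rule card_inj_on_le[where f = fst])
      show "fst ` {c\<in>?C. (\<lambda>(u,v,w) y. y = (w,v,phi u v w)) c y} \<subseteq>
          {u. adj w u \<and> s \<le> f w u \<and> cnt w s (f w u) \<le> B * (m + 1)}"
        using key by (fastforce simp: y)
    qed (auto intro!: inj_onI simp: y)
    also have "\<dots> \<le> B * (m + 1)" by (rule few_after)
    finally show "card {c\<in>?C. (\<lambda>(u,v,w) y. y = (w,v,phi u v w)) c y} \<le> B * (m + 1)" .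
  qed simp
  then show ?thesis by simp
qed

text \<open>Touchings of \<open>u\<close> have distinct ranks, and each cell has at most
  \<open>2 * W + l\<close> forbidden residues. The term \<open>card V\<close> comes from one
  possibly incomplete cell per vertex.\<close>

lemma card_near_boundary:
  "real (card {(u,v). adj u v \<and> \<not> off_boundary u v})
    \<le> (real (card darts) / real R + real (card V)) * real (2 * W + l)"
proof -
  define M where "M = {i. i < R \<and> \<not> (W \<le> i \<and> i + W + l < R)}"
  have "M \<subseteq> {..<W} \<union> {R - (W + l)..<R}" by (auto simp: M_def)
  then have "card M \<le> card ({..<W} \<union> {R - (W + l)..<R})" by (intro card_mono) auto
  also have "\<dots> \<le> card {..<W} + card {R - (W + l)..<R}" by (rule card_Un_le)
  also have "\<dots> \<le> 2 * W + l" by simp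
  finally have M: "card M \<le> 2 * W + l" .
  have fM: "finite M" by (simp add: M_def)
  have each: "real (card {v. adj u v \<and> \<not> off_boundary u v})
      \<le> (real (card {v. adj u v}) / real R + 1) * real (2 * W + l)" for u
  proof -
    define d where "d = card {v. adj u v}"
    have "{v. adj u v \<and> \<not> off_boundary u v} \<subseteq> {v. adj u v \<and> rank u (f u v) \<in> {i. i \<le> d \<and> i mod R \<in> M}}"
      using R_pos by (auto simp: off_boundary_def M_def rank_def d_def intro: card_mono)
    then have "card {v. adj u v \<and> \<not> off_boundary u v} \<le>
        card {v. adj u v \<and> rank u (f u v) \<in> {i. i \<le> d \<and> i mod R \<in> M}}"
      by (intro card_mono) auto
    also have "\<dots> \<le> card {i. i \<le> d \<and> i mod R \<in> M}" by (rule card_rank_in) simp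
    also have "\<dots> \<le> (d div R + 1) * card M" by (rule card_mod_in_le[OF R_pos fM])
    also have "\<dots> \<le> (d div R + 1) * (2 * W + l)" using M by (rule mult_le_mono2)
    finally have "real (card {v. adj u v \<and> \<not> off_boundary u v}) \<le> real ((d div R + 1) * (2 * W + l))"
      by (rule of_nat_mono)
    also have "\<dots> = (real (d div R) + 1) * real (2 * W + l)" by (simp add: algebra_simps)
    also have "\<dots> \<le> (real d / real R + 1) * real (2 * W + l)"
      by (intro mult_right_mono add_right_mono of_nat_div_le_of_nat) auto
    finally show ?thesis by (simp add: d_def)
  qed
  have "{(u,v). adj u v \<and> \<not> off_boundary u v} = (SIGMA u:V. {v. adj u v \<and> \<not> off_boundary u v})"
    using adj_V by auto
  then have "real (card {(u,v). adj u v \<and> \<not> off_boundary u v}) =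
      (\<Sum>u\<in>V. real (card {v. adj u v \<and> \<not> off_boundary u v}))"
    using finite_V by (simp add: card_SigmaI)
  also have "\<dots> \<le> (\<Sum>u\<in>V. (real (card {v. adj u v}) / real R + 1) * real (2 * W + l))"
    by (intro sum_mono each)
  also have "\<dots> = (real (card darts) / real R + real (card V)) * real (2 * W + l)"
    by (simp add: card_darts sum_distrib_right[symmetric] sum.distrib sum_divide_distrib)
  finally show ?thesis .
qed

text \<open>A twin \<open>(u1, u2, v, w)\<close> with common crossing time \<open>t\<close> is charged to the pair of consecutive
  crossings around \<open>t\<close>, if these lie in different cells of mesh \<open>m\<close>, and otherwise to the border of
  the nonempty cell containing \<open>t\<close>. In both cases \<open>v\<close> and \<open>w\<close> are among \<open>O(l)\<close> candidates.\<close>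

definition vcell :: "'a \<Rightarrow> nat \<Rightarrow> 'a set" where
  "vcell u j = {v. adj u v \<and> rank u (f u v) \<in> {j * m - l..<j * m + m}}"

definition wcell :: "'a \<Rightarrow> nat \<Rightarrow> 'a set" where
  "wcell u j = {w. adj u w \<and> rank u (f u w) \<in> {j * m..<j * m + m + l}}"

definition vgap :: "'a \<Rightarrow> real \<Rightarrow> 'a set" where
  "vgap u x = {v. adj u v \<and> f u v \<le> x \<and> cnt u (f u v) x \<le> l}"

definition wgap :: "'a \<Rightarrow> real \<Rightarrow> 'a set" where
  "wgap u y = {w. adj u w \<and> y \<le> f u w \<and> cnt u y (f u w) \<le> l}"

definition charged :: "'a \<Rightarrow> 'a \<Rightarrow> real \<Rightarrow> real \<Rightarrow> ('a \<times> 'a) set" where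
  "charged u1 u2 x y = (vgap u1 x \<union> vgap u2 x) \<times> wgap u2 y
     \<union> vcell u1 (rank u1 x div m) \<times> wcell u1 (rank u1 x div m)
     \<union> vcell u1 (rank u1 y div m) \<times> wcell u1 (rank u1 y div m)"

lemma finite_charge_sets [simp]:
  "finite (vcell u j)" "finite (wcell u j)" "finite (vgap u x)" "finite (wgap u x)"
  by (auto simp: vcell_def wcell_def vgap_def wgap_def)

lemma card_charged: "card (charged u1 u2 x y) \<le> 10 * (l * l)"
proof -
  have c1: "card (vcell u j \<times> wcell u j) \<le> 4 * (l * l)" for u j
  proof -
    have "card (vcell u j) \<le> card {j * m - l..<j * m + m}" "card (wcell u j) \<le> card {j * m..<j * m + m + l}"
      unfolding vcell_def wcell_def by (rule card_rank_in, simp)+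
    then have "card (vcell u j) \<le> 2 * l" "card (wcell u j) \<le> 2 * l" using m_le_l by auto
    then have "card (vcell u j) * card (wcell u j) \<le> (2 * l) * (2 * l)" by (rule mult_le_mono)
    then show ?thesis by (simp add: card_cartesian_product)
  qed
  have "card (vgap u1 x \<union> vgap u2 x) \<le> 2 * l"
    using card_Un_le[of "vgap u1 x" "vgap u2 x"] few_before[of u1 x l] few_before[of u2 x l]
    by (simp add: vgap_def)
  moreover have "card (wgap u2 y) \<le> l"
    unfolding wgap_def by (rule few_after)
  ultimately have "card (vgap u1 x \<union> vgap u2 x) * card (wgap u2 y) \<le> (2 * l) * l"
    by (rule mult_le_mono)
  then have c2: "card ((vgap u1 x \<union> vgap u2 x) \<times> wgap u2 y) \<le> 2 * (l * l)"
    by (simp add: card_cartesian_product)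
  have "card (charged u1 u2 x y) \<le> card ((vgap u1 x \<union> vgap u2 x) \<times> wgap u2 y)
     + card (vcell u1 (rank u1 x div m) \<times> wcell u1 (rank u1 x div m))
     + card (vcell u1 (rank u1 y div m) \<times> wcell u1 (rank u1 y div m))"
    unfolding charged_def by (meson card_Un_le add_le_mono1 order_trans)
  also have "\<dots> \<le> 10 * (l * l)"
    using c1[of u1 "rank u1 x div m"] c1[of u1 "rank u1 y div m"] c2 by linarith
  finally show ?thesis .
qed

text \<open>Both \<open>u1\<close> and \<open>u2\<close> touch \<open>v\<close> before
  \<open>t\<close> and \<open>w\<close> after \<open>t\<close>, so \<open>sep\<close> at
  \<open>v\<close> and at \<open>w\<close> gives crossings \<open>s < t < s'\<close> of
  \<open>u1\<close> and \<open>u2\<close>. They are more than \<open>m\<close> apart along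
  \<open>u1\<close> but inside one coarse cell, and a jump between fine cells occurs in
  between.\<close>

lemma twin_charges_target:
  assumes "(u1,u2,v,w) \<in> twins"
  obtains x y where "(u1,u2,y) \<in> targets m R" "x \<in> Q u1 u2" "x < y" "\<forall>z\<in>Q u1 u2. z \<le> x \<or> y \<le> z"
    "(v,w) \<in> charged u1 u2 x y"
proof -
  define t where "t = phi u1 v w"
  from assms have g1: "(u1,v,w) \<in> good" and g2: "(u2,v,w) \<in> good" and t2: "phi u2 v w = t"
    and w12: "f u1 w < f u2 w" by (auto simp: twins_def t_def)
  from g1 have a1: "adj u1 v" "adj u1 w" "f u1 v < f u1 w" "cnt u1 (f u1 v) (f u1 w) \<le> l"
    by (auto simp: good_def cherries_def)
  from g2 have a2: "adj u2 v" "adj u2 w" "f u2 v < f u2 w" "cnt u2 (f u2 v) (f u2 w) \<le> l"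
    by (auto simp: good_def cherries_def)
  have t: "f u1 v < t" "t < f u1 w" "f u2 v < t" "t < f u2 w"
    using phi[OF a1(1-3)] phi[OF a2(1-3)] t2 by (auto simp: t_def)
  have ne: "u1 \<noteq> u2" using w12 by auto
  have s1: "adj v u1" "adj w u1" "f v u1 = f u1 v" "f w u1 = f u1 w"
    and s2: "adj v u2" "adj w u2" "f v u2 = f u2 v" "f w u2 = f u2 w"
    using a1 a2 adj_sym f_sym by metis+
  have "f v u1 \<noteq> f v u2" using f_inj[OF s1(1) s2(1)] ne by auto
  then obtain s where s: "s \<in> Q u1 u2" "min (f u1 v) (f u2 v) < s" "s < max (f u1 v) (f u2 v)"
    using sep[OF s1(1) s2(1)] sep[OF s2(1) s1(1)] s1 s2 Q_sym[of u1 u2]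
    by (cases "f v u1 < f v u2") force+
  obtain s' where s': "s' \<in> Q u1 u2" "f u1 w < s'" "s' < f u2 w"
    using sep[OF s1(2) s2(2)] s1 s2 w12 by auto
  have st: "s < t" using s t by (auto simp: max_def split: if_splits)
  have st': "t < s'" using s' t by simp
  let ?r = "rank u1"
  have mono: "?r x \<le> ?r y" if "x \<le> y" for x y using monoD[OF rank_mono that] .
  \<comment> \<open>\<open>s\<close> and \<open>s'\<close> lie in different cells of size \<open>m\<close>, but in the same cell of size \<open>R\<close>\<close>
  have "m < cnt u1 t (f u1 w)" using g1 by (auto simp: good_def t_def)
  then have "?r s + (m + 1) \<le> ?r (max s (f u1 w))"
    using rank_add_cnt_le[OF st, of u1 "f u1 w"] by simp
  also have "\<dots> \<le> ?r s'" using s' st st' by (intro mono) auto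
  finally have rs: "?r s + (m + 1) \<le> ?r s'" .
  have cell_less: "?r s div m < ?r s' div m"
  proof -
    have "(?r s + m) div m \<le> ?r s' div m" using rs by (intro div_le_mono) simp
    then show ?thesis using m_pos by simp
  qed
  \<comment> \<open>Only the case where \<open>u2\<close> touches \<open>v\<close> first needs work.
    The interval between the two touchings is then bounded along \<open>u2\<close> by its cherry,
    hence along \<open>v\<close>, hence along \<open>u1\<close>.\<close>
  have lowR: "?r (f u1 v) \<le> ?r s + W"
  proof (cases "f u1 v < f u2 v")
    case True
    then show ?thesis using mono[of "f u1 v" s] s by simp
  next
    case False
    then have lt: "f u2 v < f u1 v" using \<open>f v u1 \<noteq> f v u2\<close> s1 s2 by simp
    have "cnt v (f u2 v) (f u2 w) \<le> B * l"
      using g2 not_unbRD[OF _ a2] by (simp add: good_def)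
    moreover have "cnt v (f u2 v) (f u1 v) \<le> cnt v (f u2 v) (f u2 w)"
      using t by (intro cnt_mono) auto
    ultimately have "cnt v (f v u2) (f v u1) \<le> B * l" using s1 s2 by simp
    moreover have "(v,u1) \<notin> unbL B (B * l)" using g1 by (auto simp: good_def)
    ultimately have "cnt u1 (f v u2) (f v u1) \<le> B * (B * l)"
      using not_unbLD[of v u1 B "B * l" u2] lt s1 s2 by simp
    then have "cnt u1 s (f u1 v) \<le> W"
      using cnt_mono[of "f v u2" s "f u1 v" "f u1 v" u1] s lt s1 s2 by (simp add: W_def)
    then show ?thesis using rank_le_add_cnt[of u1 "f u1 v" s] by simp
  qed
  have highR: "?r s' \<le> ?r (f u1 v) + l + W"
  proof -
    have "cnt w (f u2 v) (f u2 w) \<le> B * l"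
      using g2 not_unbLD[OF _ a2(2,1,3,4)] by (simp add: good_def)
    moreover have "cnt w (f u1 w) (f u2 w) \<le> cnt w (f u2 v) (f u2 w)"
      using t by (intro cnt_mono) auto
    ultimately have "cnt w (f w u1) (f w u2) \<le> B * l" using s1 s2 by simp
    moreover have "(w,u1) \<notin> unbR B (B * l)" using g1 by (auto simp: good_def)
    ultimately have "cnt u1 (f w u1) (f w u2) \<le> B * (B * l)"
      using not_unbRD[of w u1 B "B * l" u2] w12 s1 s2 by simp
    then have "cnt u1 (f u1 w) s' \<le> W"
      using cnt_mono[of "f u1 w" "f u1 w" s' "f u2 w" u1] s' s1 s2 by (simp add: W_def)
    then show ?thesis
      using rank_le_add_cnt[of u1 s' "f u1 w"] rank_le_add_cnt[of u1 "f u1 w" "f u1 v"] a1 by simp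
  qed
  have same_R: "?r s div R = ?r s' div R"
  proof -
    define a where "a = ?r (f u1 v)"
    have off: "W \<le> a mod R" "a mod R + W + l < R"
      using g1 by (auto simp: good_def off_boundary_def a_def)
    have a: "R * (a div R) + a mod R = a" by simp
    have cell: "i div R = a div R" if "a \<le> i + W" "i \<le> a + l + W" for i
    proof (rule div_nat_eqI)
      show "R * (a div R) \<le> i" using that off a by linarith
      show "i < R * Suc (a div R)" unfolding mult_Suc_right using that off a by linarith
    qed
    have "?r s div R = a div R" using lowR highR rs by (intro cell) (auto simp: a_def)
    moreover have "?r s' div R = a div R" using lowR highR rs by (intro cell) (auto simp: a_def)
    ultimately show ?thesis by simp
  qed
  have sandwich: "?r x div R = ?r y div R" if "s \<le> x" "x \<le> y" "y \<le> s'" for x y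
    using same_R div_le_mono[OF mono, of s x R] div_le_mono[OF mono, of x y R]
      div_le_mono[OF mono, of y s' R] that by simp
  have target: "(u1,u2,y) \<in> targets m R"
    if "x \<in> Q u1 u2" "y \<in> Q u1 u2" "x < y" "\<forall>z\<in>Q u1 u2. z \<le> x \<or> y \<le> z" "s \<le> x" "y \<le> s'"
      "?r x div m \<noteq> ?r y div m" for x y
  proof -
    have "(u1,u2,y) \<in> crossings" using that(2) ne adj_V[OF a1(1)] adj_V[OF a2(1)] by (simp add: crossings_def)
    then show ?thesis unfolding targets_def using that sandwich[of x y] by simp blast
  qed
  have in_cell: "(v,w) \<in> vcell u1 j \<times> wcell u1 j" if "?r t div m = j" for j
  proof -
    have j: "j * m \<le> ?r t" "?r t < j * m + m"
      using that div_mult_mod_eq[of "?r t" m] mod_less_divisor[OF m_pos, of "?r t"] by auto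
    have "cnt u1 (f u1 v) t \<le> l" "cnt u1 t (f u1 w) \<le> l"
      using cnt_mono[of "f u1 v" "f u1 v" t "f u1 w" u1] cnt_mono[of "f u1 v" t "f u1 w" "f u1 w" u1] t a1
      by auto
    then have "?r t \<le> ?r (f u1 v) + l" "?r (f u1 w) \<le> ?r t + l"
      using rank_le_add_cnt[of u1 t "f u1 v"] rank_le_add_cnt[of u1 "f u1 w" t] by auto
    moreover have "?r (f u1 v) \<le> ?r t" "?r t \<le> ?r (f u1 w)" using t by (auto intro: mono)
    ultimately show ?thesis using j a1 by (auto simp: vcell_def wcell_def)
  qed
  obtain x0 y0 where xy0: "x0 \<in> Q u1 u2" "y0 \<in> Q u1 u2" "s \<le> x0" "x0 < y0" "y0 \<le> s'"
    "\<forall>z\<in>Q u1 u2. z \<le> x0 \<or> y0 \<le> z" "x0 < t" "t \<le> y0"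
  proof -
    have "mono (\<lambda>x. if x < t then 0 else 1 :: nat)" by (rule monoI) auto
    from consecutive_jump[OF finite_Q s(1) s'(1) this, of 1] st st'
    obtain x y where "x \<in> Q u1 u2" "y \<in> Q u1 u2" "s \<le> x" "x < y" "y \<le> s'" "\<forall>z\<in>Q u1 u2. z \<le> x \<or> y \<le> z"
      "(if x < t then 0 else 1 :: nat) < 1" "1 \<le> (if y < t then 0 else 1 :: nat)" by auto
    then show thesis using that by (auto split: if_splits)
  qed
  show thesis
  proof (cases "?r x0 div m = ?r y0 div m")
    case False
    \<comment> \<open>Whichever of the two curves touches \<open>v\<close> first does so before
      \<open>s\<close>, hence before \<open>x0\<close>, but which one is not known. On
      \<open>w\<close> the later touching is that of \<open>u2\<close>, so \<open>wgap u2\<close>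
      suffices.\<close>
    have "v \<in> vgap u1 x0 \<union> vgap u2 x0"
    proof (cases "f u1 v < f u2 v")
      case True
      then have "f u1 v \<le> x0" using s xy0 by simp
      moreover have "cnt u1 (f u1 v) x0 \<le> l"
        using cnt_mono[of "f u1 v" "f u1 v" x0 "f u1 w" u1] a1 xy0 t by simp
      ultimately show ?thesis using a1 by (simp add: vgap_def)
    next
      case False
      then have "f u2 v \<le> x0" using s xy0 by simp
      moreover have "cnt u2 (f u2 v) x0 \<le> l"
        using cnt_mono[of "f u2 v" "f u2 v" x0 "f u2 w" u2] a2 xy0 t by simp
      ultimately show ?thesis using a2 by (simp add: vgap_def)
    qed
    moreover have "w \<in> wgap u2 y0"
    proof -
      have "cnt u2 y0 (f u2 w) \<le> l"
        using cnt_mono[of "f u2 v" y0 "f u2 w" "f u2 w" u2] a2 xy0 t by simp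
      then show ?thesis using a2 xy0 s' by (simp add: wgap_def)
    qed
    ultimately show thesis
      using that[of y0 x0] target[of x0 y0] False xy0 by (simp add: charged_def)
  next
    case True
    \<comment> \<open>The gap around \<open>t\<close> stays in the fine cell \<open>j\<close>.
      Crossings are followed out of \<open>j\<close> to the right if \<open>s'\<close> lies in a
      later cell, and otherwise back to the left. In both cases one end of the charged gap lies in
      \<open>j\<close>, so the gap reveals \<open>j\<close>.\<close>
    define j where "j = ?r x0 div m"
    have gm: "mono (\<lambda>x. ?r x div m)" by (intro monoI div_le_mono mono)
    have tj: "?r t div m = j"
      using True monoD[OF gm, of x0 t] monoD[OF gm, of t y0] xy0 by (simp add: j_def)
    show thesis
    proof (cases "j < ?r s' div m")
      case True
      have "?r s div m < j + 1" using monoD[OF gm, of s x0] xy0 by (simp add: j_def)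
      from consecutive_jump[OF finite_Q s(1) s'(1) gm this] True
      obtain x y where xy: "x \<in> Q u1 u2" "y \<in> Q u1 u2" "s \<le> x" "x < y" "y \<le> s'"
        "\<forall>z\<in>Q u1 u2. z \<le> x \<or> y \<le> z" "?r x div m < j + 1" "j + 1 \<le> ?r y div m" by auto
      have "x0 \<le> x"
        using xy monoD[OF gm, of y x0] xy0(1) by (auto simp: j_def)
      then have "?r x div m = j" using monoD[OF gm, of x0 x] xy by (simp add: j_def)
      then show thesis
        using that[of y x] target[of x y] xy in_cell[OF tj] by (simp add: charged_def)
    next
      case False
      then have sj: "?r s div m < j" using cell_less by simp
      have "j \<le> ?r s' div m" using monoD[OF gm, of x0 s'] xy0 by (simp add: j_def)
      from consecutive_jump[OF finite_Q s(1) s'(1) gm sj this]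
      obtain x y where xy: "x \<in> Q u1 u2" "y \<in> Q u1 u2" "s \<le> x" "x < y" "y \<le> s'"
        "\<forall>z\<in>Q u1 u2. z \<le> x \<or> y \<le> z" "?r x div m < j" "j \<le> ?r y div m" by auto
      have "y \<le> x0"
        using xy monoD[OF gm, of x0 x] xy0(1) by (auto simp: j_def)
      then have "?r y div m = j" using monoD[OF gm, of y x0] xy by (simp add: j_def)
      then show thesis
        using that[of y x] target[of x y] xy in_cell[OF tj] by (simp add: charged_def)
    qed
  qed
qed

lemma finite_good [simp]: "finite good"
  by (rule finite_subset[OF _ finite_cherries]) (auto simp: good_def)

lemma finite_twins [simp]: "finite twins"
proof (rule finite_subset)
  show "twins \<subseteq> (\<lambda>((u1,v,w),(u2,_,_)). (u1,u2,v,w)) ` (good \<times> good)"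
    by (force simp: twins_def)
qed simp

text \<open>A target fixes \<open>u1\<close>, \<open>u2\<close> and both ends of the gap, so only
  the choice of \<open>(v,w)\<close> in \<open>charged\<close> is left.\<close>

lemma card_twins_le: "card twins \<le> card (targets m R) * (10 * (l * l))"
proof -
  define Rl where "Rl = (\<lambda>(u1,u2,v,w) (u1',u2',y). u1' = u1 \<and> u2' = u2 \<and>
    (\<exists>x\<in>Q u1 u2. x < y \<and> (\<forall>z\<in>Q u1 u2. z \<le> x \<or> y \<le> z) \<and> (v,w) \<in> charged u1 u2 x y))"
  have "card twins * 1 \<le> card (targets m R) * (10 * (l * l))"
  proof (rule double_count[where R = Rl])
    fix c assume c: "c \<in> twins"
    obtain u1 u2 v w where cc: "c = (u1,u2,v,w)" by (cases c)
    from twin_charges_target[OF c[unfolded cc]] obtain x y where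
      "(u1,u2,y) \<in> targets m R" "x \<in> Q u1 u2" "x < y" "\<forall>z\<in>Q u1 u2. z \<le> x \<or> y \<le> z" "(v,w) \<in> charged u1 u2 x y" .
    then have "(u1,u2,y) \<in> {y\<in>targets m R. Rl c y}" by (auto simp: Rl_def cc)
    moreover have "finite {y\<in>targets m R. Rl c y}" by simp
    ultimately show "1 \<le> card {y\<in>targets m R. Rl c y}"
      by (rule one_le_card[rotated])
  next
    fix p assume "p \<in> targets m R"
    then obtain u1 u2 y x where p: "p = (u1,u2,y)" "y \<in> Q u1 u2" "x \<in> Q u1 u2" "x < y"
      "\<forall>z\<in>Q u1 u2. z \<le> x \<or> y \<le> z" by (auto simp: targets_def crossings_def)
    have uniq: "x' = x" if "x' \<in> Q u1 u2" "x' < y" "\<forall>z\<in>Q u1 u2. z \<le> x' \<or> y \<le> z" for x'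
      using that p by (meson antisym leD)
    have "card {c\<in>twins. Rl c p} \<le> card (charged u1 u2 x y)"
    proof (rule card_inj_on_le[where f = "\<lambda>(u1,u2,v,w). (v,w)"])
      show "(\<lambda>(u1,u2,v,w). (v,w)) ` {c\<in>twins. Rl c p} \<subseteq> charged u1 u2 x y"
        using uniq by (auto simp: Rl_def p(1))
      show "finite (charged u1 u2 x y)" by (simp add: charged_def)
    qed (auto intro!: inj_onI simp: Rl_def p(1))
    also have "\<dots> \<le> 10 * (l * l)" by (rule card_charged)
    finally show "card {c\<in>twins. Rl c p} \<le> 10 * (l * l)" .
  qed auto
  then show ?thesis by simp
qed

text \<open>Cherries are keyed by their crossings. Two with the same key are twins in one of the two
  orders, unless they touch \<open>w\<close> at the same time; then \<open>f_inj\<close> at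
  \<open>w\<close> makes them equal.\<close>

lemma card_good_squared:
  "(real (card good))\<^sup>2 \<le> real (card crossings) * (real (card good) + 2 * real (card twins))"
proof -
  define h where "h = (\<lambda>(u,v,w). (v,w,phi u v w))"
  have hG: "h ` good \<subseteq> crossings"
  proof (intro subsetI, elim imageE)
    fix y x assume x: "x \<in> good" and y: "y = h x"
    obtain u v w where c: "x = (u,v,w)" by (cases x)
    then have a: "adj u v" "adj u w" "f u v < f u w" using x by (auto simp: good_def cherries_def)
    then show "y \<in> crossings"
      using phi[OF a] adj_V2 by (auto simp: y c h_def crossings_def)
  qed
  let ?F = "{(x,y). x \<in> good \<and> y \<in> good \<and> h x = h y}"
  let ?g = "\<lambda>(u1,u2,v,w). ((u1,v,w),(u2,v,w))"
  have "?F \<subseteq> (\<lambda>x. (x,x)) ` good \<union> ?g ` twins \<union> (prod.swap \<circ> ?g) ` twins"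
  proof
    fix p assume p: "p \<in> ?F"
    obtain u1 v w u2 v2 w2 where pp: "p = ((u1,v,w),(u2,v2,w2))" by (metis prod.exhaust)
    have F: "(u1,v,w) \<in> good" "(u2,v2,w2) \<in> good" "h (u1,v,w) = h (u2,v2,w2)"
      using p unfolding pp by auto
    from F(3) have e: "v2 = v" "w2 = w" "phi u1 v w = phi u2 v w" by (auto simp: h_def)
    consider "f u1 w < f u2 w" | "f u2 w < f u1 w" | "f u1 w = f u2 w" by linarith
    then show "p \<in> (\<lambda>x. (x,x)) ` good \<union> ?g ` twins \<union> (prod.swap \<circ> ?g) ` twins"
    proof cases
      case 1
      then have "(u1,u2,v,w) \<in> twins" using F e by (simp add: twins_def)
      then have "p \<in> ?g ` twins" by (rule rev_image_eqI) (simp add: pp e)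
      then show ?thesis by blast
    next
      case 2
      then have "(u2,u1,v,w) \<in> twins" using F e by (simp add: twins_def)
      then have "p \<in> (prod.swap \<circ> ?g) ` twins" by (rule rev_image_eqI) (simp add: pp e)
      then show ?thesis by blast
    next
      case 3
      have a: "adj u1 w" "adj u2 w" using F e by (auto simp: good_def cherries_def)
      then have "u1 = u2" using 3 f_inj[OF adj_sym[OF a(1)] adj_sym[OF a(2)]] f_sym[OF a(1)] f_sym[OF a(2)] by simp
      then have "p \<in> (\<lambda>x. (x,x)) ` good" using F e by (simp add: pp)
      then show ?thesis by blast
    qed
  qed
  then have "card ?F \<le> card ((\<lambda>x. (x,x)) ` good \<union> ?g ` twins \<union> (prod.swap \<circ> ?g) ` twins)"
    by (intro card_mono) auto
  also have "\<dots> \<le> card ((\<lambda>x. (x,x)) ` good) + card (?g ` twins) + card ((prod.swap \<circ> ?g) ` twins)"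
    by (meson card_Un_le add_le_mono1 order_trans)
  also have "\<dots> \<le> card good + card twins + card twins"
    by (intro add_mono card_image_le) auto
  finally have "real (card ?F) \<le> real (card good) + 2 * real (card twins)" by simp
  then show ?thesis
    using card_fibre_pairs_ge[OF finite_good finite_crossings hG]
    by (meson mult_left_mono of_nat_0_le_iff order_trans)
qed

text \<open>\<open>B = 100 * K\<close> makes each of the five unbalanced families cost one percent
  of \<open>l * D\<close>, where \<open>D = card darts\<close>. The choice of \<open>l\<close>
  bounds the noncentral cherries by two percent, and \<open>R = 300 * W\<close> those near a coarse
  border by two percent. With the deficit from \<open>card_cherries_ge\<close>, well over half
  remains.\<close>

lemma card_good_ge:
  fixes K :: nat
  assumes K: "K \<ge> 1" and B: "B = 100 * K" and l: "l = 10000 * K\<^sup>2 * m" and R: "R = 300 * W"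
    and X: "card crossings \<le> K * card darts" and N: "card V * R \<le> card darts"
  shows "real l * real (card darts) / 2 \<le> real (card good)"
proof -
  define D where "D = real (card darts)"
  define L where "L = real l"
  have D0: "D \<ge> 0" and L0: "L > 0" using l_pos by (auto simp: D_def L_def)
  have LD0: "0 \<le> L * D" using D0 L0 by simp
  have unb: "real (card U * l) \<le> L * D / 100" if "card U * B \<le> card crossings" for U :: "('a \<times> 'a) set"
  proof -
    have "card U * (100 * K) \<le> K * card darts" using that X unfolding B by (rule order_trans)
    then have "K * (100 * card U) \<le> K * card darts" by (simp add: mult_ac)
    then have "100 * card U \<le> card darts" using K by (simp only: mult_le_cancel1)
    then have "100 * real (card U) \<le> D" unfolding D_def by linarith
    then have "L * (100 * real (card U)) \<le> L * D" using L0 by (intro mult_left_mono) auto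
    then show ?thesis by (simp add: L_def mult.commute)
  qed
  let ?c = "\<lambda>P. {(u,v,w). (u,v,w) \<in> cherries \<and> P u v w}"
  have c1: "real (card (?c (\<lambda>u v w. (u,v) \<in> unbR B l))) \<le> L * D / 100"
    using of_nat_mono[OF card_cherries_first[of "unbR B l"], where 'a = real] unb[OF card_unbR[OF l_pos]]
    by simp
  have c2: "real (card (?c (\<lambda>u v w. (v,u) \<in> unbL B (B * l)))) \<le> L * D / 100"
    using of_nat_mono[OF card_cherries_first[of "(unbL B (B * l))\<inverse>"], where 'a = real]
      unb[OF card_unbL, of "B * l"] l_pos B_pos
    by (simp add: card_inverse)
  have c3: "real (card (?c (\<lambda>u v w. (u,w) \<in> unbL B l))) \<le> L * D / 100"
    using of_nat_mono[OF card_cherries_second[of "unbL B l"], where 'a = real] unb[OF card_unbL[OF l_pos]]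
    by simp
  have c4: "real (card (?c (\<lambda>u v w. (w,u) \<in> unbR B (B * l)))) \<le> L * D / 100"
    using of_nat_mono[OF card_cherries_second[of "(unbR B (B * l))\<inverse>"], where 'a = real]
      unb[OF card_unbR, of "B * l"] l_pos B_pos
    by (simp add: card_inverse)
  have c5: "real (card (?c (\<lambda>u v w. (u,w) \<in> unbL B (m + 1)))) \<le> L * D / 100"
    using of_nat_mono[OF card_cherries_second[of "unbL B (m + 1)"], where 'a = real] unb[OF card_unbL, of "m + 1"]
    by simp
  have c6: "real (card (?c (\<lambda>u v w. (u,w) \<notin> unbL B (m + 1) \<and> cnt u (phi u v w) (f u w) \<le> m))) \<le> L * D / 50"
  proof -
    have "card crossings * (B * (m + 1)) \<le> (K * card darts) * (100 * K * (2 * m))"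
      unfolding B using X m_pos by (intro mult_le_mono) auto
    also have "50 * \<dots> = l * card darts" by (simp add: l power2_eq_square)
    finally have "50 * (card crossings * (B * (m + 1))) \<le> l * card darts" by simp
    with card_noncentral
    have "50 * card (?c (\<lambda>u v w. (u,w) \<notin> unbL B (m + 1) \<and> cnt u (phi u v w) (f u w) \<le> m)) \<le> l * card darts"
      by linarith
    then have "real (50 * card (?c (\<lambda>u v w. (u,w) \<notin> unbL B (m + 1) \<and> cnt u (phi u v w) (f u w) \<le> m)))
        \<le> real (l * card darts)" by (rule of_nat_mono)
    then show ?thesis by (simp add: L_def D_def)
  qed
  have lW: "l \<le> W" using B_pos by (simp add: W_def)
  have W0: "W > 0" using lW l_pos by simp
  have NR: "real (card V) * real R \<le> D" unfolding D_def using N by (metis of_nat_mono of_nat_mult)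
  have c7: "real (card (?c (\<lambda>u v w. \<not> off_boundary u v))) \<le> L * D / 50"
  proof -
    have "real (card {(u,v). adj u v \<and> \<not> off_boundary u v}) \<le> (D / real R + real (card V)) * real (3 * W)"
      unfolding D_def using lW by (intro order_trans[OF card_near_boundary mult_left_mono]) auto
    also have "\<dots> = D / 100 + real (card V) * real R / 100"
      using W0 by (simp add: R field_simps)
    also have "\<dots> \<le> D / 50" using NR by linarith
    finally have b: "real (card {(u,v). adj u v \<and> \<not> off_boundary u v}) \<le> D / 50" .
    have fin: "finite {(u,v). adj u v \<and> \<not> off_boundary u v}"
      by (rule finite_subset[OF _ finite_darts]) (auto simp: darts_def)
    have "?c (\<lambda>u v w. \<not> off_boundary u v) = ?c (\<lambda>u v w. (u,v) \<in> {(u,v). adj u v \<and> \<not> off_boundary u v})"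
      by (auto simp: cherries_def)
    then have "real (card (?c (\<lambda>u v w. \<not> off_boundary u v))) \<le> real (card {(u,v). adj u v \<and> \<not> off_boundary u v} * l)"
      using card_cherries_first[OF fin] by (metis (no_types, lifting) of_nat_mono)
    also have "\<dots> \<le> D / 50 * L" using b L0 by (simp add: L_def mult_right_mono)
    finally show ?thesis by (simp add: mult.commute)
  qed
  have Un_bound: "card (M \<union> M') \<le> a + b" if "card M \<le> a" "card M' \<le> b" for M M' :: "('a \<times> 'a \<times> 'a) set" and a b
    using card_Un_le[of M M'] that by linarith
  have "cherries \<subseteq> good \<union> ?c (\<lambda>u v w. (u,v) \<in> unbR B l) \<union> ?c (\<lambda>u v w. (v,u) \<in> unbL B (B * l))
      \<union> ?c (\<lambda>u v w. (u,w) \<in> unbL B l) \<union> ?c (\<lambda>u v w. (w,u) \<in> unbR B (B * l))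
      \<union> ?c (\<lambda>u v w. (u,w) \<in> unbL B (m + 1))
      \<union> ?c (\<lambda>u v w. (u,w) \<notin> unbL B (m + 1) \<and> cnt u (phi u v w) (f u w) \<le> m)
      \<union> ?c (\<lambda>u v w. \<not> off_boundary u v)" (is "_ \<subseteq> ?U")
    by (auto simp: good_def not_less)
  moreover have "finite ?U"
    by (rule finite_subset[OF _ finite_cherries]) (auto simp: good_def)
  ultimately have "card cherries \<le> card ?U" by (rule card_mono[rotated])
  also have "\<dots> \<le> card good + card (?c (\<lambda>u v w. (u,v) \<in> unbR B l)) + card (?c (\<lambda>u v w. (v,u) \<in> unbL B (B * l)))
      + card (?c (\<lambda>u v w. (u,w) \<in> unbL B l)) + card (?c (\<lambda>u v w. (w,u) \<in> unbR B (B * l)))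
      + card (?c (\<lambda>u v w. (u,w) \<in> unbL B (m + 1)))
      + card (?c (\<lambda>u v w. (u,w) \<notin> unbL B (m + 1) \<and> cnt u (phi u v w) (f u w) \<le> m))
      + card (?c (\<lambda>u v w. \<not> off_boundary u v))"
    by (intro Un_bound order_refl)
  finally have "real (card cherries) \<le> real (card good + card (?c (\<lambda>u v w. (u,v) \<in> unbR B l))
      + card (?c (\<lambda>u v w. (v,u) \<in> unbL B (B * l)))
      + card (?c (\<lambda>u v w. (u,w) \<in> unbL B l)) + card (?c (\<lambda>u v w. (w,u) \<in> unbR B (B * l)))
      + card (?c (\<lambda>u v w. (u,w) \<in> unbL B (m + 1)))
      + card (?c (\<lambda>u v w. (u,w) \<notin> unbL B (m + 1) \<and> cnt u (phi u v w) (f u w) \<le> m))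
      + card (?c (\<lambda>u v w. \<not> off_boundary u v)))" by (rule of_nat_mono)
  then have "real (card cherries) \<le> real (card good) + 5 * (L * D / 100) + 2 * (L * D / 50)"
    unfolding of_nat_add using c1 c2 c3 c4 c5 c6 c7 by linarith
  moreover have "L * D - D \<le> real (card cherries) + L * D / 300"
  proof -
    have "real (card darts * (l - 1)) \<le> real (card cherries + card V * l * l)"
      using card_cherries_ge by (rule of_nat_mono)
    then have "D * (L - 1) \<le> real (card cherries) + real (card V) * L * L"
      using l_pos by (simp add: D_def L_def of_nat_diff)
    moreover have "real (card V) * (300 * L) \<le> D"
    proof -
      have "real (card V) * (300 * L) \<le> real (card V) * real R"
        using lW by (intro mult_left_mono) (auto simp: R L_def)
      then show ?thesis using NR by simp
    qed
    then have "real (card V) * (300 * L) * L \<le> D * L" using L0 by (intro mult_right_mono) auto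
    ultimately show ?thesis by (simp add: algebra_simps)
  qed
  moreover have "10000 * D \<le> L * D"
  proof -
    have "10000 * 1 * 1 \<le> 10000 * K\<^sup>2 * m" using K m_pos by (intro mult_le_mono) auto
    then have "10000 \<le> L" unfolding L_def l by linarith
    then show ?thesis using D0 by (intro mult_right_mono) auto
  qed
  ultimately have "L * D / 2 \<le> real (card good)" using LD0 by linarith
  then show ?thesis by (simp add: L_def D_def)
qed

text \<open>The number \<open>G\<close> of good cherries lies between \<open>L * D / 2\<close> and
  \<open>L * D\<close>. Inserted in \<open>card_good_squared\<close>, this bounds the twins from
  below, and \<open>card_twins_le\<close> divides by \<open>10 * L^2\<close>.\<close>

lemma card_targets_ge:
  fixes K :: nat
  assumes "K \<ge> 1" "B = 100 * K" "l = 10000 * K\<^sup>2 * m" "R = 300 * W"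
    and X: "card crossings \<le> K * card darts" and "card V * R \<le> card darts"
  shows "card darts \<le> 100 * K * card (targets m R)"
proof (cases "card darts = 0")
  case False
  define D where "D = real (card darts)"
  define L where "L = real l"
  define G where "G = real (card good)"
  define T where "T = real (card twins)"
  have D0: "D > 0" and L0: "L > 0" and K0: "real K > 0" using l_pos False assms(1) by (auto simp: D_def L_def)
  have G: "L * D / 2 \<le> G" using card_good_ge[OF assms] by (simp add: L_def D_def G_def)
  have "good \<subseteq> {(u,v,w). (u,v,w) \<in> cherries \<and> (u,v) \<in> darts}"
    by (auto simp: good_def cherries_def darts_def)
  moreover have "finite {(u,v,w). (u,v,w) \<in> cherries \<and> (u,v) \<in> darts}"
    by (rule finite_subset[OF _ finite_cherries]) auto
  ultimately have "card good \<le> card darts * l"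
    using card_cherries_first[OF finite_darts] by (meson card_mono order_trans)
  then have G2: "G \<le> L * D" unfolding G_def L_def D_def by (metis mult.commute of_nat_mono of_nat_mult)
  have X': "real (card crossings) \<le> real K * D" unfolding D_def using X by (metis of_nat_mono of_nat_mult)
  have "(L * D / 2)\<^sup>2 \<le> G\<^sup>2" using G L0 D0 by (intro power_mono) auto
  also have "\<dots> \<le> real (card crossings) * (G + 2 * T)"
    using card_good_squared by (simp add: G_def T_def)
  also have "\<dots> \<le> (real K * D) * (L * D + 2 * T)"
    using X' G2 G L0 D0 by (intro mult_mono add_mono) (auto simp: T_def G_def)
  finally have "D * (L * L * D / 4) \<le> D * (real K * (L * D + 2 * T))"
    by (simp add: power2_eq_square algebra_simps)
  then have A: "L * L * D / 4 \<le> real K * (L * D + 2 * T)" using D0 by (rule mult_left_le_imp_le)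
  \<comment> \<open>\<open>l\<close> exceeds \<open>K\<close> so much that the diagonal pairs, each
    cherry with itself, are negligible.\<close>
  have "10000 * K * 1 * 1 \<le> 10000 * K * K * m" using assms(1) m_pos by (intro mult_le_mono) auto
  then have "10000 * K \<le> l" unfolding assms(3) power2_eq_square by (simp only: mult_1_right mult.assoc)
  then have "10000 * real K \<le> L" unfolding L_def by linarith
  then have "10000 * real K * (L * D) \<le> L * (L * D)" using L0 D0 by (intro mult_right_mono) auto
  then have a: "10000 * (real K * (L * D)) \<le> L * L * D" by (simp only: mult.assoc)
  have "T \<le> real (card (targets m R)) * (10 * (L * L))"
    unfolding T_def L_def using of_nat_mono[OF card_twins_le, where 'a = real] by simp
  then have "real K * T \<le> real K * (real (card (targets m R)) * (10 * (L * L)))"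
    using K0 by (intro mult_left_mono) auto
  then have b: "real K * T \<le> 10 * (L * L * (real K * real (card (targets m R))))" by (simp only: mult_ac)
  have "L * L * D / 4 \<le> real K * (L * D) + 2 * (real K * T)"
    using A by (simp only: distrib_left mult_ac)
  moreover have "0 \<le> L * L * D" using L0 D0 by simp
  ultimately have "L * L * D / 5 \<le> 20 * (L * L * (real K * real (card (targets m R))))"
    using a b by linarith
  then have "L * L * (D / 5) \<le> L * L * (20 * real K * real (card (targets m R)))" by simp
  then have "D / 5 \<le> 20 * real K * real (card (targets m R))" 
    using L0 by (subst (asm) mult_le_cancel_left_pos) auto
  then have "real (card darts) \<le> real (100 * K * card (targets m R))" by (simp add: D_def)
  then show ?thesis by (rule of_nat_le_iff[THEN iffD1])
qed simp

end

section \<open>Summation over the scales\<close>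

context touch_system
begin

text \<open>Each of \<open>101 * K^2\<close> scales has at least
  \<open>card darts / (100 * K)\<close> targets, and these are disjoint, which is too many for
  \<open>K * card darts\<close> crossings. The ratio is
  \<open>300 * W / m = 300 * (100 * K)^2 * 10000 * K^2\<close>. The hypothesis on
  \<open>card V\<close> keeps even the coarsest mesh below the average degree.\<close>

theorem many_crossings:
  fixes K :: nat
  assumes K: "K \<ge> 1" and D: "darts \<noteq> {}"
    and N: "card V * (30000000000 * K ^ 4) ^ (101 * K\<^sup>2) \<le> card darts"
  shows "K * card darts < card crossings"
proof (rule ccontr)
  assume "\<not> ?thesis"
  then have X: "card crossings \<le> K * card darts" by simp
  define r where "r = 30000000000 * K ^ 4"
  define h where "h = 101 * K\<^sup>2"
  have r: "r \<ge> 1" using K by (simp add: r_def)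
  have *: "card darts \<le> 100 * K * card (targets (r ^ i) (r ^ Suc i))" if "i < h" for i
  proof -
    define l where "l = 10000 * K\<^sup>2 * r ^ i"
    interpret touch_scale V adj f Q "100 * K" l "r ^ i" "r ^ Suc i"
      using K r by unfold_locales (auto simp: l_def)
    have "card V * r ^ Suc i \<le> card V * r ^ h"
      using that r by (intro mult_le_mono2 power_increasing) auto
    also have "\<dots> \<le> card darts" using N by (simp add: r_def h_def)
    finally have "card V * r ^ Suc i \<le> card darts" .
    moreover have "r ^ Suc i = 300 * W"
    proof -
      have "300 * W = 30000000000 * K ^ 4 * r ^ i"
        unfolding W_def unfolding l_def by (simp add: power4_eq_xxxx power2_eq_square)
      then show ?thesis by (simp add: r_def)
    qed
    ultimately show ?thesis using card_targets_ge[OF K refl l_def _ X] by simp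
  qed
  have "h * card darts = (\<Sum>i<h. card darts)" by simp
  also have "\<dots> \<le> (\<Sum>i<h. 100 * K * card (targets (r ^ i) (r ^ Suc i)))"
    using * by (intro sum_mono) auto
  also have "\<dots> \<le> 100 * K * card crossings"
    using sum_card_targets_le[of r h] by (simp flip: sum_distrib_left)
  also have "\<dots> \<le> 100 * K * (K * card darts)" using X by simp
  finally have "101 * (K\<^sup>2 * card darts) \<le> 100 * (K\<^sup>2 * card darts)"
    unfolding h_def power2_eq_square by (simp only: mult_ac)
  moreover have "K\<^sup>2 * card darts > 0" using D K by (simp add: card_gt_0_iff)
  ultimately show False by linarith
qed

end

section \<open>Touching closed curves do not cross\<close>

lemma zero_between:
  fixes h :: "real \<Rightarrow> real"
  assumes "continuous_on {a..b} h" "a \<le> b" "0 \<le> h a" "h b \<le> 0"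
  obtains y where "y \<in> {a..b}" "h y = 0"
  using IVT2'[OF assms(4,3,2,1)] by auto

text \<open>\<open>Re\<close> is a homeomorphism from the compact connected arc onto an interval,
  and \<open>F\<close> is the imaginary part of its inverse. The interval is nondegenerate because
  an arc has distinct ends.\<close>

lemma x_monotone_arc_graph:
  assumes "x_monotone_arc a"
  obtains L R F where "L < R" "continuous_on {L..R} F" "a = (\<lambda>x. Complex x (F x)) ` {L..R}"
proof -
  obtain g where g: "arc g" "path_image g = a" and inj: "inj_on Re a"
    using assms by (auto simp: x_monotone_arc_def)
  have comp: "compact a" and conn: "connected a"
    using g compact_arc_image connected_arc_image by auto
  have cRe: "continuous_on a Re" by (intro continuous_intros)
  have "compact (Re ` a)" "connected (Re ` a)"
    using comp conn cRe compact_continuous_image connected_continuous_image by auto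
  then obtain L R where LR: "Re ` a = {L..R}"
    using connected_compact_interval_1[of "Re ` a"] by auto
  define h where "h = the_inv_into a Re"
  have h: "h (Re z) = z" if "z \<in> a" for z using inj that by (simp add: h_def the_inv_into_f_f)
  have ch: "continuous_on {L..R} h"
    using continuous_on_inv[OF cRe comp, of h] h LR by auto
  have hx: "h x \<in> a \<and> Re (h x) = x" if "x \<in> {L..R}" for x
    using that h unfolding LR[symmetric] by auto
  have "pathstart g \<in> a" "pathfinish g \<in> a" "pathstart g \<noteq> pathfinish g"
    using g(2) arc_distinct_ends[OF g(1)] by auto
  then have "Re (pathstart g) \<noteq> Re (pathfinish g)" "Re (pathstart g) \<in> {L..R}" "Re (pathfinish g) \<in> {L..R}"
    using inj LR by (auto simp: inj_on_def)
  then have "L < R" by auto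
  moreover have "continuous_on {L..R} (\<lambda>x. Im (h x))" by (intro continuous_intros ch)
  moreover have "a = (\<lambda>x. Complex x (Im (h x))) ` {L..R}"
  proof
    show "a \<subseteq> (\<lambda>x. Complex x (Im (h x))) ` {L..R}"
    proof
      fix z assume z: "z \<in> a"
      then have "z = Complex (Re z) (Im (h (Re z)))" using h by simp
      moreover have "Re z \<in> {L..R}" using z LR by blast
      ultimately show "z \<in> (\<lambda>x. Complex x (Im (h x))) ` {L..R}" by blast
    qed
    show "(\<lambda>x. Complex x (Im (h x))) ` {L..R} \<subseteq> a"
    proof (intro subsetI, elim imageE)
      fix z x assume "z = Complex x (Im (h x))" "x \<in> {L..R}"
      then have "z = h x" using hx[of x] by (simp add: complex_eq_iff)
      then show "z \<in> a" using hx \<open>x \<in> {L..R}\<close> by blast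
    qed
  qed
  ultimately show thesis by (rule that)
qed

lemma closed_curve_param:
  assumes "closed_curve \<alpha>" "p \<in> \<alpha>"
  obtains g where "simple_path g" "pathfinish g = pathstart g" "path_image g = \<alpha>" "pathstart g = p"
proof -
  obtain g where g: "simple_path g" "pathfinish g = pathstart g" "path_image g = \<alpha>"
    using assms by (auto simp: closed_curve_def)
  obtain t where t: "t \<in> {0..1}" "g t = p" using assms g by (auto simp: path_image_def)
  show thesis
  proof
    show "simple_path (shiftpath t g)" using simple_path_shiftpath[OF g(1,2)] t by auto
    show "pathfinish (shiftpath t g) = pathstart (shiftpath t g)" using closed_shiftpath[OF g(2)] t by auto
    show "path_image (shiftpath t g) = \<alpha>" using path_image_shiftpath[of t g] t g by auto
    show "pathstart (shiftpath t g) = p" using pathstart_shiftpath[of t g] t by auto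
  qed
qed

lemma connected_closed_curve_delete:
  assumes "closed_curve \<alpha>" "p \<in> \<alpha>"
  shows "connected (\<alpha> - {p})"
proof -
  obtain g where "simple_path g" "pathfinish g = pathstart g" "path_image g = \<alpha>" "pathstart g = p"
    using closed_curve_param[OF assms] .
  then show ?thesis using connected_simple_path_endless[of g] by simp
qed

text \<open>A piece of graph around the point fills a parameter interval with the point's parameter
  in its interior. The remaining parameters have a compact image that misses the point, hence stays
  at a positive distance.\<close>

lemma closed_curve_locally_graph:
  assumes \<alpha>: "closed_curve \<alpha>" and F: "continuous_on {L..R} F" and x0: "L < x0" "x0 < R"
    and sub: "(\<lambda>x. Complex x (F x)) ` {L..R} \<subseteq> \<alpha>"
  obtains e where "e > 0" "ball (Complex x0 (F x0)) e \<inter> \<alpha> \<subseteq> (\<lambda>x. Complex x (F x)) ` {L..R}"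
proof -
  define p where "p = Complex x0 (F x0)"
  let ?G = "\<lambda>x. Complex x (F x)"
  \<comment> \<open>With the base point at the left end of the graph and the graph cut back to
    \<open>{a..R}\<close>, the piece used avoids the one double point of the
    parametrization.\<close>
  define c where "c = Complex L (F L)"
  have c: "c \<in> \<alpha>" using sub x0 by (auto simp: c_def)
  obtain g where g: "simple_path g" "pathfinish g = pathstart g" "path_image g = \<alpha>" "pathstart g = c"
    using closed_curve_param[OF \<alpha> c] .
  have gc: "continuous_on {0..1} g" using g(1) by (simp add: simple_path_def path_def)
  have g_inj: "s = t" if "s \<in> {0<..<1}" "t \<in> {0..1}" "g s = g t" for s t
    using g(1) that unfolding simple_path_def loop_free_def by fastforce
  define a where "a = (L + x0) / 2"
  have a: "L < a" "a < x0" using x0 by (auto simp: a_def)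
  define A where "A = ?G ` {a..R}"
  have GF: "continuous_on {a..R} ?G"
    using continuous_on_subset[OF F, of "{a..R}"] a by (auto simp: Complex_eq intro!: continuous_intros)
  have compA: "compact A" unfolding A_def by (intro compact_continuous_image GF) auto
  define T where "T = {t \<in> {0..1}. g t \<in> A}"
  have cA: "c \<notin> A" using a by (auto simp: A_def c_def)
  have gends: "g 0 = c" "g 1 = c" using g by (auto simp: pathstart_def pathfinish_def)
  have T01: "T \<subseteq> {0<..<1}"
  proof
    fix t assume t: "t \<in> T"
    then have "t \<noteq> 0" "t \<noteq> 1" using cA gends by (auto simp: T_def)
    then show "t \<in> {0<..<1}" using t by (auto simp: T_def)
  qed
  have "closed T"
  proof -
    have "T = {0..1} \<inter> g -` A" by (auto simp: T_def)
    then show ?thesis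
      using continuous_closed_preimage[OF gc closed_atLeastAtMost compact_imp_closed[OF compA]] by simp
  qed
  then have "compact ({0..1} \<inter> T)" by (intro compact_Int_closed) auto
  moreover have "{0..1} \<inter> T = T" by (auto simp: T_def)
  ultimately have compT: "compact T" by simp
  have gT: "g ` T = A"
  proof
    show "A \<subseteq> g ` T"
    proof
      fix z assume z: "z \<in> A"
      then have "z \<in> \<alpha>" using sub a by (auto simp: A_def)
      then obtain t where "t \<in> {0..1}" "g t = z" using g(3) by (auto simp: path_image_def)
      then show "z \<in> g ` T" using z by (auto simp: T_def)
    qed
  qed (auto simp: T_def)
  have injT: "inj_on g T"
  proof (rule inj_onI)
    fix s t assume "s \<in> T" "t \<in> T" "g s = g t"
    then show "s = t" using g_inj[of s t] T01 by (auto simp: T_def)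
  qed
  define k where "k = the_inv_into T g"
  have k: "k (g t) = t" if "t \<in> T" for t using injT that by (simp add: k_def the_inv_into_f_f)
  have ck: "continuous_on A k"
  proof -
    have "T \<subseteq> {0..1}" by (auto simp: T_def)
    then show ?thesis
      using continuous_on_inv[OF continuous_on_subset[OF gc] compT, of k] k gT by simp
  qed
  have gk: "g (k z) = z \<and> k z \<in> T" if "z \<in> A" for z using that k unfolding gT[symmetric] by auto
  define q where "q = (\<lambda>x. k (?G x))"
  have cq: "continuous_on {a..R} q" unfolding q_def
    by (rule continuous_on_compose2[OF ck GF]) (auto simp: A_def)
  have gq: "g (q x) = ?G x" "q x \<in> T" if "x \<in> {a..R}" for x
    using gk[of "?G x"] that by (auto simp: q_def A_def)
  have iq: "inj_on q {a..R}"
  proof (rule inj_onI)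
    fix x y assume "x \<in> {a..R}" "y \<in> {a..R}" "q x = q y"
    then have "?G x = ?G y" using gq by metis
    then show "x = y" by simp
  qed
  define lo hi where "lo = min (q a) (q R)" and "hi = max (q a) (q R)"
  have mid: "lo < q x0" "q x0 < hi"
    using continuous_inj_imp_mono[OF a(2) x0(2) cq iq] by (auto simp: lo_def hi_def)
  have cover: "t \<in> q ` {a..R}" if "lo < t" "t < hi" for t
  proof -
    have "connected (q ` {a..R})" using cq by (intro connected_continuous_image) auto
    moreover have "lo \<in> q ` {a..R}" "hi \<in> q ` {a..R}"
      using a x0 by (auto simp: lo_def hi_def min_def max_def)
    ultimately show ?thesis using that connectedD_interval[of "q ` {a..R}" lo hi t] by auto
  qed
  define C where "C = g ` ({0..1} - {lo<..<hi})"
  have "compact ({0..1} - {lo<..<hi})" by (intro compact_diff) auto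
  then have "closed C" unfolding C_def
    by (intro compact_imp_closed compact_continuous_image continuous_on_subset[OF gc]) auto
  moreover have "p \<notin> C"
  proof
    assume "p \<in> C"
    then obtain t where t: "t \<in> {0..1}" "t \<notin> {lo<..<hi}" "g t = p" by (auto simp: C_def)
    have "q x0 \<in> {0<..<1}" "g (q x0) = p" using gq[of x0] a x0 T01 by (auto simp: p_def)
    then have "q x0 = t" using g_inj t by metis
    then show False using t mid by auto
  qed
  ultimately obtain e where e: "e > 0" "ball p e \<subseteq> - C"
    by (meson open_contains_ball open_Compl ComplI)
  show thesis
  proof (rule that[OF e(1)])
    show "ball (Complex x0 (F x0)) e \<inter> \<alpha> \<subseteq> ?G ` {L..R}"
    proof
      fix z assume z: "z \<in> ball (Complex x0 (F x0)) e \<inter> \<alpha>"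
      then obtain t where t: "t \<in> {0..1}" "g t = z" using g(3) by (auto simp: path_image_def)
      have "z \<notin> C" using z e by (auto simp: p_def)
      then have "lo < t" "t < hi" using t by (auto simp: C_def)
      then obtain x where x: "x \<in> {a..R}" "t = q x" using cover by blast
      then have "z = ?G x" using gq t by auto
      then show "z \<in> ?G ` {L..R}" using x a by auto
    qed
  qed
qed

text \<open>The set is swept out by the open vertical segments from the graph of \<open>F\<close> to
  the line at height \<open>c\<close>.\<close>

lemma connected_vertical_strip:
  fixes F :: "real \<Rightarrow> real"
  assumes "continuous_on {a<..<b} F"
  shows "connected ((\<lambda>(x,t). Complex x (F x + t * (c - F x))) ` ({a<..<b} \<times> {0<..<1::real}))"
proof (rule connected_continuous_image)
  have "continuous_on ({a<..<b} \<times> {0<..<1::real}) (\<lambda>y. F (fst y))"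
    by (rule continuous_on_compose2[OF assms]) (auto intro!: continuous_intros)
  then show "continuous_on ({a<..<b} \<times> {0<..<1::real}) (\<lambda>(x,t). Complex x (F x + t * (c - F x)))"
    unfolding case_prod_beta Complex_eq by (intro continuous_intros)
  show "connected ({a<..<b} \<times> {0<..<1::real})"
    by (intro connected_Times) auto
qed

text \<open>A small rectangle around \<open>p\<close> is cut by \<open>\<alpha>\<close> into the part above and the part below the
  graph. If \<open>\<beta> - {p}\<close>, which is connected and avoids \<open>\<alpha>\<close>, met both parts, then only one of the two
  components of the complement of \<open>\<alpha>\<close> would accumulate at \<open>p\<close>.\<close>

lemma single_common_point_not_crossing:
  assumes \<alpha>: "closed_curve \<alpha>" and \<beta>: "closed_curve \<beta>" and ab: "\<alpha> \<inter> \<beta> = {Complex x0 (F x0)}"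
    and F: "continuous_on {L..R} F" "(\<lambda>x. Complex x (F x)) ` {L..R} \<subseteq> \<alpha>"
    and G: "continuous_on {L'..R'} G" "(\<lambda>x. Complex x (G x)) ` {L'..R'} \<subseteq> \<beta>"
    and x0: "L < x0" "x0 < R" "L' < x0" "x0 < R'" and Gx0: "G x0 = F x0"
    and x1: "x1 < x0" "L \<le> x1" "L' \<le> x1" "F x1 < G x1"
    and x2: "x0 < x2" "x2 \<le> R" "x2 \<le> R'" "G x2 < F x2"
  shows False
proof -
  define p where "p = Complex x0 (F x0)"
  have ne: "F x \<noteq> G x" if "x \<in> {L..R}" "x \<in> {L'..R'}" "x \<noteq> x0" for x
  proof
    assume "F x = G x"
    then have "Complex x (F x) \<in> \<alpha> \<inter> \<beta>" using F(2) G(2) that by force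
    then show False using ab that by auto
  qed
  have left: "F x < G x" if "x1 \<le> x" "x < x0" for x
  proof (rule ccontr)
    assume "\<not> F x < G x"
    then have s: "G x - F x \<le> 0" "0 \<le> G x1 - F x1" using x1 by auto
    have "continuous_on {x1..x} (\<lambda>x. G x - F x)"
      using x1 x0 that by (intro continuous_intros continuous_on_subset[OF F(1)] continuous_on_subset[OF G(1)]) auto
    from zero_between[OF this that(1) s(2,1)] obtain y where "y \<in> {x1..x}" "G y - F y = 0" .
    then show False using ne[of y] x1 x0 that by auto
  qed
  have right: "G x < F x" if "x0 < x" "x \<le> x2" for x
  proof (rule ccontr)
    assume "\<not> G x < F x"
    then have s: "G x2 - F x2 \<le> 0" "0 \<le> G x - F x" using x2 by auto
    have "continuous_on {x..x2} (\<lambda>x. G x - F x)"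
      using x2 x0 that by (intro continuous_intros continuous_on_subset[OF F(1)] continuous_on_subset[OF G(1)]) auto
    from zero_between[OF this that(2) s(2,1)] obtain y where "y \<in> {x..x2}" "G y - F y = 0" .
    then show False using ne[of y] x2 x0 that by auto
  qed
  obtain e where e: "e > 0" "ball p e \<inter> \<alpha> \<subseteq> (\<lambda>x. Complex x (F x)) ` {L..R}"
    using closed_curve_locally_graph[OF \<alpha> F(1) x0(1,2) F(2)] unfolding p_def by blast
  \<comment> \<open>Half-width at most \<open>h\<close> and half-height \<open>h\<close> put the box
    \<open>P\<close> into the ball of radius \<open>e = h + h\<close>, where \<alpha> is just the
    graph.\<close>
  define h where "h = e / 2"
  have h: "h > 0" "e = h + h" using e(1) by (auto simp: h_def)
  have "isCont F x0" "isCont G x0"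
    using F(1) G(1) x0 by (auto intro: continuous_on_interior)
  then have "\<exists>d>0. \<forall>x. dist x x0 < d \<longrightarrow> dist (F x) (F x0) < h"
    "\<exists>d>0. \<forall>x. dist x x0 < d \<longrightarrow> dist (G x) (G x0) < h"
    unfolding continuous_at_eps_delta using h(1) by blast+
  then obtain d1 d2 where d: "d1 > 0" "\<And>x. dist x x0 < d1 \<Longrightarrow> dist (F x) (F x0) < h"
    "d2 > 0" "\<And>x. dist x x0 < d2 \<Longrightarrow> dist (G x) (G x0) < h"
    by blast
  define \<delta> where "\<delta> = min (min d1 d2) (min (h) (min (x0 - x1) (x2 - x0)))"
  have \<delta>: "\<delta> > 0" "\<delta> \<le> d1" "\<delta> \<le> d2" "\<delta> \<le> h" "\<delta> \<le> x0 - x1" "\<delta> \<le> x2 - x0"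
    unfolding \<delta>_def using d(1,3) h(1) x1(1) x2(1) by linarith+
  define a b where "a = x0 - \<delta>" and "b = x0 + \<delta>"
  have Fb: "\<bar>F x - F x0\<bar> < h" and Gb: "\<bar>G x - F x0\<bar> < h" if "a < x" "x < b" for x
    using d(2)[of x] d(4)[of x] \<delta> that Gx0 by (auto simp: a_def b_def dist_real_def)
  have dom: "L < x" "x < R" "L' < x" "x < R'" "x1 \<le> x" "x \<le> x2" if "a < x" "x < b" for x
    using that \<delta> x1 x2 by (auto simp: a_def b_def)
  define P where "P = {z. a < Re z \<and> Re z < b \<and> \<bar>Im z - F x0\<bar> < h}"
  have P_ball: "P \<subseteq> ball p e"
  proof
    fix z assume z: "z \<in> P"
    have "norm (p - z) \<le> \<bar>Re (p - z)\<bar> + \<bar>Im (p - z)\<bar>" by (rule cmod_le)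
    also have "\<dots> = \<bar>x0 - Re z\<bar> + \<bar>F x0 - Im z\<bar>" by (simp add: p_def)
    also have "\<dots> < e"
    proof -
      have "\<bar>x0 - Re z\<bar> < \<delta>" "\<bar>F x0 - Im z\<bar> < h"
        using z by (auto simp: P_def a_def b_def abs_less_iff abs_minus_commute[of "F x0"])
      then show ?thesis using \<delta>(4) h(2) by linarith
    qed
    finally show "z \<in> ball p e" by (simp add: dist_norm)
  qed
  have openP: "open P"
  proof -
    have "P = {z. a < Re z} \<inter> {z. Re z < b} \<inter> {z. F x0 - h < Im z} \<inter> {z. Im z < F x0 + h}"
      by (auto simp: P_def abs_less_iff)
    then show ?thesis
      by (auto intro!: open_Int open_halfspace_Re_gt open_halfspace_Re_lt open_halfspace_Im_gt open_halfspace_Im_lt)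
  qed
  have pP: "p \<in> P" using \<delta> h by (auto simp: P_def p_def a_def b_def)
  define strip where "strip = (\<lambda>c. (\<lambda>(x,t). Complex x (F x + t * (c - F x))) ` ({a<..<b} \<times> {0<..<1::real}))"
  have conn_strip: "connected (strip c)" for c
    unfolding strip_def
    by (rule connected_vertical_strip[OF continuous_on_subset[OF F(1)]]) (use dom in force)
  define U where "U = strip (F x0 + h)"
  define W where "W = strip (F x0 - h)"
  have graph: "Im z = F (Re z)" if "z \<in> P" "z \<in> \<alpha>" for z
  proof -
    have "z \<in> (\<lambda>x. Complex x (F x)) ` {L..R}" using that P_ball e(2) by blast
    then show ?thesis by auto
  qed
  have strip_avoid: "strip c \<inter> \<alpha> = {}" if c: "c = F x0 + h \<or> c = F x0 - h" for c
  proof (rule ccontr)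
    assume "strip c \<inter> \<alpha> \<noteq> {}"
    then obtain x t where x: "a < x" "x < b" and t: "0 < t" "t < 1"
      and in\<alpha>: "Complex x (F x + t * (c - F x)) \<in> \<alpha>" by (auto simp: strip_def)
    let ?z = "Complex x (F x + t * (c - F x))"
    have nz: "c - F x \<noteq> 0" using Fb[OF x] c by (auto simp: abs_less_iff)
    have "\<bar>(1 - t) * (F x - F x0) + t * (c - F x0)\<bar> < h"
    proof -
      have "\<bar>(1 - t) * (F x - F x0) + t * (c - F x0)\<bar> \<le> \<bar>(1 - t) * (F x - F x0)\<bar> + \<bar>t * (c - F x0)\<bar>"
        by (rule abs_triangle_ineq)
      also have "\<dots> = (1 - t) * \<bar>F x - F x0\<bar> + t * (h)"
        using c t h(1) by (auto simp: abs_mult)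
      also have "\<dots> < (1 - t) * (h) + t * (h)"
        using Fb[OF x] t by (intro add_strict_right_mono mult_strict_left_mono) auto
      also have "\<dots> = h" by (simp add: algebra_simps)
      finally show ?thesis .
    qed
    then have "?z \<in> P" using x by (simp add: P_def algebra_simps)
    then have "t * (c - F x) = 0" using graph[OF _ in\<alpha>] by simp
    then show False using t nz by simp
  qed
  have U_above: "z \<in> U" if "z \<in> P" "F (Re z) < Im z" for z
  proof -
    let ?x = "Re z" and ?c = "F x0 + h"
    have x: "a < ?x" "?x < b" "Im z < ?c" using that by (auto simp: P_def abs_less_iff)
    define t where "t = (Im z - F ?x) / (?c - F ?x)"
    have "?c - F ?x > 0" using x that by simp
    then have "0 < t" "t < 1" "t * (?c - F ?x) = Im z - F ?x"
      using x that by (auto simp: t_def)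
    then show ?thesis unfolding U_def strip_def
      using x by (intro image_eqI[of _ _ "(?x, t)"]) (auto simp: complex_eq_iff)
  qed
  have W_below: "z \<in> W" if "z \<in> P" "Im z < F (Re z)" for z
  proof -
    let ?x = "Re z" and ?c = "F x0 - h"
    have x: "a < ?x" "?x < b" "?c < Im z" using that by (auto simp: P_def abs_less_iff)
    define t where "t = (F ?x - Im z) / (F ?x - ?c)"
    have "F ?x - ?c > 0" using x that by simp
    then have "0 < t" "t < 1" "t * (F ?x - ?c) = F ?x - Im z"
      using x that by (auto simp: t_def)
    then show ?thesis unfolding W_def strip_def
      using x by (intro image_eqI[of _ _ "(?x, t)"]) (auto simp: complex_eq_iff algebra_simps)
  qed
  define za zb where "za = Complex (x0 - \<delta> / 2) (G (x0 - \<delta> / 2))" and "zb = Complex (x0 + \<delta> / 2) (G (x0 + \<delta> / 2))"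
  have xs: "a < x0 - \<delta> / 2" "x0 - \<delta> / 2 < b" "a < x0 + \<delta> / 2" "x0 + \<delta> / 2 < b"
    using \<delta> by (auto simp: a_def b_def)
  have "za \<in> P" "zb \<in> P" using xs Gb by (auto simp: P_def za_def zb_def)
  moreover have "F (Re za) < Im za" "Im zb < F (Re zb)"
    using left[of "x0 - \<delta> / 2"] right[of "x0 + \<delta> / 2"] dom[OF xs(1,2)] dom[OF xs(3,4)] \<delta>
    by (auto simp: za_def zb_def)
  ultimately have zU: "za \<in> U" and zW: "zb \<in> W" using U_above W_below by auto
  have z\<beta>: "za \<in> \<beta> - {p}" "zb \<in> \<beta> - {p}"
    using G(2) dom[OF xs(1,2)] dom[OF xs(3,4)] \<delta> by (auto simp: za_def zb_def p_def)
  \<comment> \<open>\<open>Z\<close> joins the two sides of the graph through \<beta> without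
    meeting \<alpha>, so it lies in a single component of the complement of \<alpha>.\<close>
  define Z where "Z = (U \<union> (\<beta> - {p})) \<union> W"
  have "p \<in> \<beta>" using ab by (auto simp: p_def)
  then have "connected (\<beta> - {p})" by (rule connected_closed_curve_delete[OF \<beta>])
  then have connZ: "connected Z"
    unfolding Z_def U_def W_def
    using zU zW z\<beta> conn_strip by (intro connected_Un) (auto simp: U_def W_def)
  have Z\<alpha>: "Z \<inter> \<alpha> = {}"
    using strip_avoid ab by (auto simp: Z_def U_def W_def p_def)
  obtain g where g: "simple_path g" "pathfinish g = pathstart g" "path_image g = \<alpha>"
    using \<alpha> by (auto simp: closed_curve_def)
  note J = Jordan_inside_outside[OF g(1,2), unfolded g(3)]
  \<comment> \<open>By the Jordan curve theorem both components accumulate at \<open>p\<close>. So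
    both meet the box, which \<open>Z\<close> and \<alpha> cover, and hence both meet
    \<open>Z\<close>.\<close>
  have "p \<in> \<alpha>" using ab by (auto simp: p_def)
  then have "p \<in> frontier (inside \<alpha>)" "p \<in> frontier (outside \<alpha>)" using J by auto
  then have "P \<inter> inside \<alpha> \<noteq> {}" "P \<inter> outside \<alpha> \<noteq> {}"
    using pP open_Int_closure_eq_empty[OF openP] unfolding frontier_def by blast+
  moreover have "P \<subseteq> Z \<union> \<alpha>"
  proof
    fix z assume z: "z \<in> P"
    consider "F (Re z) < Im z" | "Im z < F (Re z)" | "Im z = F (Re z)" by linarith
    then show "z \<in> Z \<union> \<alpha>"
    proof cases
      case 3
      then have "z = Complex (Re z) (F (Re z))" by (simp add: complex_eq_iff)
      moreover have "Re z \<in> {L..R}" using z dom[of "Re z"] by (auto simp: P_def)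
      ultimately show ?thesis using F(2) by blast
    qed (use z U_above W_below in \<open>auto simp: Z_def\<close>)
  qed
  moreover have "inside \<alpha> \<inter> \<alpha> = {}" "outside \<alpha> \<inter> \<alpha> = {}"
    using inside_no_overlap outside_no_overlap by auto
  ultimately have "Z \<inter> inside \<alpha> \<noteq> {}" "Z \<inter> outside \<alpha> \<noteq> {}" by blast+
  moreover have "Z \<subseteq> inside \<alpha> \<union> outside \<alpha>" using Z\<alpha> inside_Un_outside[of \<alpha>] by auto
  moreover have "inside \<alpha> \<inter> outside \<alpha> \<inter> Z = {}" using inside_Int_outside[of \<alpha>] by auto
  moreover have "open (inside \<alpha>)" "open (outside \<alpha>)" using J by auto
  ultimately show False using connectedD[OF connZ] by (metis inf_commute)
qed

text \<open>Either the first arc ends before \<open>x2\<close>, or the second begins after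
  \<open>x1\<close>, or both cover the interval and the intermediate value theorem applies. The
  order premises are conditional because neither arc need reach the abscissa of the other.\<close>

lemma graphs_meet_between:
  fixes G1 G2 :: "real \<Rightarrow> real"
  assumes "continuous_on {L1..R1} G1" "continuous_on {L2..R2} G2"
    and "x1 < x2" "L1 < x1" "x1 < R1" "L2 < x2" "x2 < R2"
    and d1: "x1 \<in> {L2..R2} \<Longrightarrow> G2 x1 < G1 x1" and d2: "x2 \<in> {L1..R1} \<Longrightarrow> G1 x2 < G2 x2"
  obtains s where "x1 < s" "s < x2" "s = R1 \<or> s = L2 \<or> (s \<in> {L1..R1} \<and> s \<in> {L2..R2} \<and> G1 s = G2 s)"
proof (cases "R1 < x2 \<or> x1 < L2")
  case True
  then show thesis using that[of R1] that[of L2] assms by auto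
next
  case False
  then have sub: "{x1..x2} \<subseteq> {L1..R1}" "{x1..x2} \<subseteq> {L2..R2}" using assms by auto
  have cont: "continuous_on {x1..x2} (\<lambda>x. G1 x - G2 x)"
    by (intro continuous_intros continuous_on_subset[OF assms(1) sub(1)] continuous_on_subset[OF assms(2) sub(2)])
  have pos: "G1 x1 - G2 x1 > 0" "G1 x2 - G2 x2 < 0" using d1 d2 False assms by auto
  from zero_between[OF cont less_imp_le[OF assms(3)] less_imp_le[OF pos(1)] less_imp_le[OF pos(2)]]
  obtain s where s: "s \<in> {x1..x2}" "G1 s - G2 s = 0" .
  have "s \<noteq> x1" "s \<noteq> x2" using s pos by auto
  then show thesis using that[of s] s sub by auto
qed

section \<open>Families of curves\<close>

lemma nonzero_same_sign:
  fixes h :: "real \<Rightarrow> real"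
  assumes "continuous_on {a..b} h" "\<And>x. x \<in> {a..b} \<Longrightarrow> h x \<noteq> 0" "x \<in> {a..b}" "y \<in> {a..b}" "h x < 0"
  shows "h y < 0"
proof (rule ccontr)
  assume "\<not> h y < 0"
  have "connected (h ` {a..b})" using assms(1) by (intro connected_continuous_image) auto
  then have "0 \<in> h ` {a..b}"
    using connectedD_interval[of "h ` {a..b}" "h x" "h y" 0] assms(3-5) \<open>\<not> h y < 0\<close> by auto
  then show False using assms(2) by auto
qed

locale curve_family =
  fixes S :: "complex set set" and k :: nat
    and L R :: "complex set \<Rightarrow> nat \<Rightarrow> real" and F :: "complex set \<Rightarrow> nat \<Rightarrow> real \<Rightarrow> real"
  assumes finite_S: "finite S" and closed_curve: "\<gamma> \<in> S \<Longrightarrow> closed_curve \<gamma>"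
    and gp: "general_position S"
    and F_cont: "\<gamma> \<in> S \<Longrightarrow> i < k \<Longrightarrow> continuous_on {L \<gamma> i..R \<gamma> i} (F \<gamma> i)"
    and dec: "\<gamma> \<in> S \<Longrightarrow> \<gamma> = (\<Union>i<k. (\<lambda>x. Complex x (F \<gamma> i x)) ` {L \<gamma> i..R \<gamma> i})"
begin

lemma finite_Int: "\<alpha> \<in> S \<Longrightarrow> \<beta> \<in> S \<Longrightarrow> \<alpha> \<noteq> \<beta> \<Longrightarrow> finite (\<alpha> \<inter> \<beta>)"
  using gp by (simp add: general_position_def)

lemma at_most_two:
  "p \<in> \<alpha> \<Longrightarrow> p \<in> \<beta> \<Longrightarrow> p \<in> \<gamma> \<Longrightarrow> \<alpha> \<in> S \<Longrightarrow> \<beta> \<in> S \<Longrightarrow> \<gamma> \<in> S \<Longrightarrow> \<alpha> \<noteq> \<beta> \<Longrightarrow> \<gamma> = \<alpha> \<or> \<gamma> = \<beta>"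
  using gp unfolding general_position_def by (metis Int_iff empty_iff)

lemma graph_sub: "\<gamma> \<in> S \<Longrightarrow> i < k \<Longrightarrow> (\<lambda>x. Complex x (F \<gamma> i x)) ` {L \<gamma> i..R \<gamma> i} \<subseteq> \<gamma>"
  using dec[of \<gamma>] by auto

lemma graph_mem: "\<gamma> \<in> S \<Longrightarrow> i < k \<Longrightarrow> x \<in> {L \<gamma> i..R \<gamma> i} \<Longrightarrow> Complex x (F \<gamma> i x) \<in> \<gamma>"
  using graph_sub by blast

text \<open>The order is required on the whole common interval, not only near \<open>p\<close>,
  since it is evaluated at the abscissae of other touchings.\<close>

definition above :: "complex set \<Rightarrow> complex set \<Rightarrow> nat \<Rightarrow> nat \<Rightarrow> complex \<Rightarrow> bool" where
  "above \<alpha> \<beta> i j p \<longleftrightarrow> \<alpha> \<in> S \<and> \<beta> \<in> S \<and> \<alpha> \<noteq> \<beta> \<and> \<alpha> \<inter> \<beta> = {p} \<and>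
     L \<alpha> i < Re p \<and> Re p < R \<alpha> i \<and> L \<beta> j < Re p \<and> Re p < R \<beta> j \<and>
     F \<alpha> i (Re p) = Im p \<and> F \<beta> j (Re p) = Im p \<and>
     (\<forall>x. x \<in> {L \<alpha> i..R \<alpha> i} \<longrightarrow> x \<in> {L \<beta> j..R \<beta> j} \<longrightarrow> x \<noteq> Re p \<longrightarrow> F \<beta> j x < F \<alpha> i x)"

lemma aboveD:
  assumes "above \<alpha> \<beta> i j p"
  shows "\<alpha> \<in> S" "\<beta> \<in> S" "\<alpha> \<noteq> \<beta>" "\<alpha> \<inter> \<beta> = {p}" "p \<in> \<alpha>" "p \<in> \<beta>"
    "L \<alpha> i < Re p" "Re p < R \<alpha> i" "L \<beta> j < Re p" "Re p < R \<beta> j"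
    "Im p = F \<alpha> i (Re p)" "F \<beta> j (Re p) = F \<alpha> i (Re p)"
  using assms unfolding above_def by auto

lemma above_less:
  "above \<alpha> \<beta> i j p \<Longrightarrow> x \<in> {L \<alpha> i..R \<alpha> i} \<Longrightarrow> x \<in> {L \<beta> j..R \<beta> j} \<Longrightarrow> x \<noteq> Re p \<Longrightarrow> F \<beta> j x < F \<alpha> i x"
  unfolding above_def by blast

text \<open>If both fail, the difference takes both signs away from \<open>Re p\<close>. On one side
  of \<open>p\<close> this would produce a second common point; on opposite sides it is excluded by
  \<open>single_common_point_not_crossing\<close>.\<close>

lemma above_or_below:
  assumes S: "\<alpha> \<in> S" "\<beta> \<in> S" "\<alpha> \<noteq> \<beta>" and p: "\<alpha> \<inter> \<beta> = {p}" and k: "i < k" "j < k"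
    and int: "L \<alpha> i < Re p" "Re p < R \<alpha> i" "L \<beta> j < Re p" "Re p < R \<beta> j"
    and eq: "F \<alpha> i (Re p) = Im p" "F \<beta> j (Re p) = Im p"
  shows "above \<alpha> \<beta> i j p \<or> above \<beta> \<alpha> j i p"
proof (rule ccontr)
  assume not: "\<not> ?thesis"
  let ?I = "{L \<alpha> i..R \<alpha> i} \<inter> {L \<beta> j..R \<beta> j}"
  let ?h = "\<lambda>x. F \<alpha> i x - F \<beta> j x"
  have pc: "p = Complex (Re p) (F \<alpha> i (Re p))" "p = Complex (Re p) (F \<beta> j (Re p))"
    using eq by (auto simp: complex_eq_iff)
  have ne: "?h x \<noteq> 0" if "x \<in> ?I" "x \<noteq> Re p" for x
  proof
    assume "?h x = 0"
    then have "Complex x (F \<alpha> i x) \<in> \<alpha> \<inter> \<beta>"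
      using graph_mem[OF S(1) k(1), of x] graph_mem[OF S(2) k(2), of x] that by simp
    then show False using p that by auto
  qed
  obtain x where x: "x \<in> ?I" "x \<noteq> Re p" "?h x < 0"
  proof -
    have "\<exists>x. x \<in> {L \<alpha> i..R \<alpha> i} \<and> x \<in> {L \<beta> j..R \<beta> j} \<and> x \<noteq> Re p \<and> \<not> F \<beta> j x < F \<alpha> i x"
      using not assms unfolding above_def by blast
    then obtain x where "x \<in> ?I" "x \<noteq> Re p" "\<not> F \<beta> j x < F \<alpha> i x" by blast
    then show thesis using ne[of x] that[of x] by linarith
  qed
  obtain y where y: "y \<in> ?I" "y \<noteq> Re p" "?h y > 0"
  proof -
    have "\<beta> \<inter> \<alpha> = {p}" using p by (simp add: Int_commute)
    then have "\<exists>x. x \<in> {L \<beta> j..R \<beta> j} \<and> x \<in> {L \<alpha> i..R \<alpha> i} \<and> x \<noteq> Re p \<and> \<not> F \<alpha> i x < F \<beta> j x"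
      using not assms unfolding above_def by blast
    then obtain x where "x \<in> ?I" "x \<noteq> Re p" "\<not> F \<alpha> i x < F \<beta> j x" by blast
    then show thesis using ne[of x] that[of x] by linarith
  qed
  have same_side: False if "Re p < min x y \<or> max x y < Re p"
  proof -
    have sub: "{min x y..max x y} \<subseteq> ?I" using x(1) y(1) by auto
    have c: "continuous_on {min x y..max x y} ?h"
      using sub by (intro continuous_intros continuous_on_subset[OF F_cont[OF S(1) k(1)]]
          continuous_on_subset[OF F_cont[OF S(2) k(2)]]) auto
    have nz: "?h z \<noteq> 0" if "z \<in> {min x y..max x y}" for z
    proof (rule ne)
      show "z \<in> ?I" using that sub by blast
      show "z \<noteq> Re p" using that \<open>Re p < min x y \<or> max x y < Re p\<close> by auto
    qed
    have "?h y < 0"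
      by (rule nonzero_same_sign[OF c nz _ _ x(3)]) auto
    then show False using y by simp
  qed
  consider "x < Re p" "Re p < y" | "y < Re p" "Re p < x" | "Re p < min x y \<or> max x y < Re p"
    using x(2) y(2) by linarith
  then show False
  proof cases
    case 1
    show False
      by (rule single_common_point_not_crossing[OF closed_curve[OF S(1)] closed_curve[OF S(2)] _
            F_cont[OF S(1) k(1)] graph_sub[OF S(1) k(1)] F_cont[OF S(2) k(2)] graph_sub[OF S(2) k(2)],
            of "Re p" x y]) (use 1 x y int eq p pc in auto)
  next
    case 2
    show False
      by (rule single_common_point_not_crossing[OF closed_curve[OF S(2)] closed_curve[OF S(1)] _
            F_cont[OF S(2) k(2)] graph_sub[OF S(2) k(2)] F_cont[OF S(1) k(1)] graph_sub[OF S(1) k(1)],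
            of "Re p" y x]) (use 2 x y int eq p pc in \<open>auto simp: Int_commute\<close>)
  next
    case 3
    then show False by (rule same_side)
  qed
qed

definition endpoint :: "complex set \<Rightarrow> nat \<Rightarrow> bool \<Rightarrow> complex" where
  "endpoint \<gamma> i b = (let x = if b then R \<gamma> i else L \<gamma> i in Complex x (F \<gamma> i x))"

definition endpoint_pairs :: "complex set set set" where
  "endpoint_pairs = {{\<gamma>, \<gamma>'} | \<gamma> \<gamma>'. \<gamma> \<in> S \<and> \<gamma>' \<in> S \<and> \<gamma> \<noteq> \<gamma>' \<and> (\<exists>i<k. \<exists>b. endpoint \<gamma> i b \<in> \<gamma> \<inter> \<gamma>')}"

definition edges :: "nat \<Rightarrow> nat \<Rightarrow> (complex set \<times> complex set) set" where
  "edges i j = {(\<alpha>, \<beta>). \<exists>p. above \<alpha> \<beta> i j p}"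

lemma finite_edges [simp]: "finite (edges i j)"
  by (rule finite_subset[of _ "S \<times> S"]) (auto simp: edges_def above_def finite_S)

lemma finite_endpoint_pairs [simp]: "finite endpoint_pairs"
  by (rule finite_subset[of _ "Pow S"]) (auto simp: endpoint_pairs_def finite_S)

text \<open>In general position each of the \<open>2 * k * card S\<close> arc ends lies on at most
  one other curve.\<close>

lemma card_endpoint_pairs: "card endpoint_pairs \<le> 2 * k * card S"
proof -
  define Rl where "Rl = (\<lambda>e (\<gamma>, i, b). \<exists>\<gamma>'. e = {\<gamma>, \<gamma>'} \<and> \<gamma>' \<in> S \<and> \<gamma> \<noteq> \<gamma>' \<and> endpoint \<gamma> i b \<in> \<gamma> \<inter> \<gamma>')"
  have "card endpoint_pairs * 1 \<le> card (S \<times> {..<k} \<times> (UNIV :: bool set)) * 1"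
  proof (rule double_count[where R = Rl])
    fix e assume "e \<in> endpoint_pairs"
    then obtain \<gamma> \<gamma>' i b where "e = {\<gamma>, \<gamma>'}" "\<gamma> \<in> S" "\<gamma>' \<in> S" "\<gamma> \<noteq> \<gamma>'" "i < k" "endpoint \<gamma> i b \<in> \<gamma> \<inter> \<gamma>'"
      by (auto simp: endpoint_pairs_def)
    then have "(\<gamma>, i, b) \<in> {y \<in> S \<times> {..<k} \<times> UNIV. Rl e y}" by (auto simp: Rl_def)
    moreover have "finite {y \<in> S \<times> {..<k} \<times> (UNIV :: bool set). Rl e y}" using finite_S by simp
    ultimately show "1 \<le> card {y \<in> S \<times> {..<k} \<times> UNIV. Rl e y}"
      by (rule one_le_card[rotated])
  next
    fix y assume "y \<in> S \<times> {..<k} \<times> (UNIV :: bool set)"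
    then obtain \<gamma> i b where y: "y = (\<gamma>, i, b)" "\<gamma> \<in> S" by auto
    have "e = e'" if "Rl e y" "Rl e' y" for e e'
    proof -
      from that obtain \<delta> \<delta>' where d: "e = {\<gamma>, \<delta>}" "e' = {\<gamma>, \<delta>'}" "\<delta> \<in> S" "\<delta>' \<in> S" "\<gamma> \<noteq> \<delta>" "\<gamma> \<noteq> \<delta>'"
        "endpoint \<gamma> i b \<in> \<gamma>" "endpoint \<gamma> i b \<in> \<delta>" "endpoint \<gamma> i b \<in> \<delta>'" by (auto simp: Rl_def y)
      then have "\<delta>' = \<delta>" using at_most_two[of _ \<gamma> \<delta> \<delta>'] y by auto
      then show ?thesis using d by simp
    qed
    then show "card {x \<in> endpoint_pairs. Rl x y} \<le> 1"
      by (auto simp: card_le_Suc0_iff_eq)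
  qed (auto simp: finite_S)
  then show ?thesis by (simp add: card_cartesian_product mult_ac)
qed

lemma touching_pairs_cover:
  "touching_pairs S \<subseteq> endpoint_pairs \<union> (\<Union>(i,j)\<in>{..<k} \<times> {..<k}. (\<lambda>(\<alpha>,\<beta>). {\<alpha>,\<beta>}) ` edges i j)"
proof
  fix e assume "e \<in> touching_pairs S"
  then obtain \<alpha> \<beta> p where e: "e = {\<alpha>, \<beta>}" "\<alpha> \<in> S" "\<beta> \<in> S" "\<alpha> \<noteq> \<beta>" "\<alpha> \<inter> \<beta> = {p}"
    by (auto simp: touching_pairs_def touch_def touching_point_def)
  then have "p \<in> \<alpha>" "p \<in> \<beta>" by auto
  then obtain i j where ij: "i < k" "j < k" "p \<in> (\<lambda>x. Complex x (F \<alpha> i x)) ` {L \<alpha> i..R \<alpha> i}"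
    "p \<in> (\<lambda>x. Complex x (F \<beta> j x)) ` {L \<beta> j..R \<beta> j}"
    using dec[OF e(2)] dec[OF e(3)] by blast
  then have a: "Re p \<in> {L \<alpha> i..R \<alpha> i}" "F \<alpha> i (Re p) = Im p" and b: "Re p \<in> {L \<beta> j..R \<beta> j}" "F \<beta> j (Re p) = Im p"
    by auto
  have end_pair: "{\<gamma>, \<gamma>'} \<in> endpoint_pairs"
    if "\<gamma> \<in> S" "\<gamma>' \<in> S" "\<gamma> \<noteq> \<gamma>'" "i < k" "Re p = L \<gamma> i \<or> Re p = R \<gamma> i" "F \<gamma> i (Re p) = Im p" "p \<in> \<gamma> \<inter> \<gamma>'" for \<gamma> \<gamma>' i
  proof -
    have "endpoint \<gamma> i (Re p = R \<gamma> i) = p" using that by (auto simp: endpoint_def complex_eq_iff)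
    then have "\<exists>i<k. \<exists>b. endpoint \<gamma> i b \<in> \<gamma> \<inter> \<gamma>'"
      using that(4,7) by (intro exI[of _ i] conjI exI[of _ "Re p = R \<gamma> i"]) auto
    then show ?thesis unfolding endpoint_pairs_def mem_Collect_eq
      using that(1-3) by (intro exI[of _ \<gamma>] exI[of _ \<gamma>'] conjI refl)
  qed
  show "e \<in> endpoint_pairs \<union> (\<Union>(i,j)\<in>{..<k} \<times> {..<k}. (\<lambda>(\<alpha>,\<beta>). {\<alpha>,\<beta>}) ` edges i j)"
  proof (cases "e \<in> endpoint_pairs")
    case False
    then have "Re p \<noteq> L \<alpha> i" "Re p \<noteq> R \<alpha> i" "Re p \<noteq> L \<beta> j" "Re p \<noteq> R \<beta> j"
      using end_pair[of \<alpha> \<beta> i] end_pair[of \<beta> \<alpha> j] e ij a b \<open>p \<in> \<alpha>\<close> \<open>p \<in> \<beta>\<close> by (auto simp: insert_commute)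
    then have "above \<alpha> \<beta> i j p \<or> above \<beta> \<alpha> j i p"
      using a b by (intro above_or_below[OF e(2-5) ij(1,2)]) auto
    then have "(\<alpha>, \<beta>) \<in> edges i j \<or> (\<beta>, \<alpha>) \<in> edges j i" by (auto simp: edges_def)
    then show ?thesis
    proof
      assume "(\<alpha>, \<beta>) \<in> edges i j"
      then have "e \<in> (\<lambda>(\<alpha>,\<beta>). {\<alpha>,\<beta>}) ` edges i j" by (rule rev_image_eqI) (simp add: e)
      then show ?thesis using ij by auto
    next
      assume "(\<beta>, \<alpha>) \<in> edges j i"
      then have "e \<in> (\<lambda>(\<alpha>,\<beta>). {\<alpha>,\<beta>}) ` edges j i" by (rule rev_image_eqI) (simp add: e insert_commute)
      then show ?thesis using ij by auto
    qed
  qed simp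
qed

text \<open>Pigeonhole over the \<open>k^2\<close> pairs of arc indices, after discarding touchings
  at arc ends.\<close>

lemma many_edges:
  assumes "0 < k"
  obtains i j where "i < k" "j < k" "card (touching_pairs S) \<le> 2 * k * card S + k\<^sup>2 * card (edges i j)"
proof -
  let ?IJ = "{..<k} \<times> {..<k}"
  define c where "c = Max ((\<lambda>(i,j). card (edges i j)) ` ?IJ)"
  have "c \<in> (\<lambda>(i,j). card (edges i j)) ` ?IJ"
    unfolding c_def using assms by (intro Max_in) auto
  then obtain i j where ij: "i < k" "j < k" "c = card (edges i j)" by auto
  have le: "card (edges i j) \<le> c" if "i < k" "j < k" for i j
    unfolding c_def using that by (intro Max_ge) (auto intro!: image_eqI[of _ _ "(i,j)"])
  have "card (touching_pairs S) \<le> card (endpoint_pairs \<union> (\<Union>(i,j)\<in>?IJ. (\<lambda>(\<alpha>,\<beta>). {\<alpha>,\<beta>}) ` edges i j))"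
    by (rule card_mono[OF _ touching_pairs_cover]) auto
  also have "\<dots> \<le> card endpoint_pairs + card (\<Union>(i,j)\<in>?IJ. (\<lambda>(\<alpha>,\<beta>). {\<alpha>,\<beta>}) ` edges i j)"
    by (rule card_Un_le)
  also have "card (\<Union>(i,j)\<in>?IJ. (\<lambda>(\<alpha>,\<beta>). {\<alpha>,\<beta>}) ` edges i j) \<le>
      (\<Sum>(i,j)\<in>?IJ. card ((\<lambda>(\<alpha>,\<beta>). {\<alpha>,\<beta>}) ` edges i j))"
    using card_UN_le[of ?IJ "\<lambda>(i,j). (\<lambda>(\<alpha>,\<beta>). {\<alpha>,\<beta>}) ` edges i j"] by (simp add: case_prod_unfold)
  also have "\<dots> \<le> (\<Sum>(i,j)\<in>?IJ. c)"
    by (rule sum_mono) (auto intro: order_trans[OF card_image_le le])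
  also have "\<dots> = k\<^sup>2 * c" by (simp add: power2_eq_square)
  finally show thesis using that[OF ij(1,2)] card_endpoint_pairs ij(3) by simp
qed

lemma finite_crossing_points: "finite (crossing_points S)"
proof (rule finite_subset)
  show "crossing_points S \<subseteq> (\<Union>\<alpha>\<in>S. \<Union>\<beta>\<in>S - {\<alpha>}. \<alpha> \<inter> \<beta>)"
    by (fastforce simp: crossing_points_def crossing_point_def)
  show "finite (\<Union>\<alpha>\<in>S. \<Union>\<beta>\<in>S - {\<alpha>}. \<alpha> \<inter> \<beta>)"
    using finite_S by (intro finite_UN_I finite_Diff finite_Int) auto
qed

definition incidences :: "(complex set \<times> complex set \<times> complex) set" where
  "incidences = {(\<alpha>, \<beta>, p). \<alpha> \<in> S \<and> \<beta> \<in> S \<and> \<alpha> \<noteq> \<beta> \<and> p \<in> \<alpha> \<inter> \<beta>}"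

lemma finite_incidences [simp]: "finite incidences"
proof (rule finite_subset)
  show "incidences \<subseteq> (\<Union>\<alpha>\<in>S. \<Union>\<beta>\<in>S - {\<alpha>}. {\<alpha>} \<times> {\<beta>} \<times> (\<alpha> \<inter> \<beta>))"
    by (auto simp: incidences_def)
  show "finite (\<Union>\<alpha>\<in>S. \<Union>\<beta>\<in>S - {\<alpha>}. {\<alpha>} \<times> {\<beta>} \<times> (\<alpha> \<inter> \<beta>))"
    using finite_S by (intro finite_UN_I finite_cartesian_product finite_Diff finite_Int) auto
qed

text \<open>A point lies on at most two curves, and a touching pair has one common point, so either
  gives at most two ordered triples.\<close>

lemma card_incidences: "card incidences \<le> 2 * card (crossing_points S) + 2 * card (touching_pairs S)"
proof -
  let ?C = "{(\<alpha>, \<beta>, p). (\<alpha>, \<beta>, p) \<in> incidences \<and> crossing_point \<alpha> \<beta> p}"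
  let ?T = "{(\<alpha>, \<beta>, p). (\<alpha>, \<beta>, p) \<in> incidences \<and> touching_point \<alpha> \<beta> p}"
  have finC: "finite ?C" and finT: "finite ?T"
    by (rule finite_subset[OF _ finite_incidences]; auto)+
  have "card ?C * 1 \<le> card (crossing_points S) * 2"
  proof (rule double_count[where R = "\<lambda>(\<alpha>, \<beta>, p) q. q = p"])
    fix c assume c: "c \<in> ?C"
    then obtain \<alpha> \<beta> p where cc: "c = (\<alpha>, \<beta>, p)" "\<alpha> \<in> S" "\<beta> \<in> S" "\<alpha> \<noteq> \<beta>" "crossing_point \<alpha> \<beta> p"
      by (auto simp: incidences_def)
    then have "{y \<in> crossing_points S. (case c of (\<alpha>, \<beta>, p) \<Rightarrow> \<lambda>q. q = p) y} = {p}"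
      by (auto simp: crossing_points_def)
    then show "1 \<le> card {y \<in> crossing_points S. (case c of (\<alpha>, \<beta>, p) \<Rightarrow> \<lambda>q. q = p) y}" by simp
  next
    fix q assume "q \<in> crossing_points S"
    then obtain \<alpha> \<beta> where ab: "\<alpha> \<in> S" "\<beta> \<in> S" "\<alpha> \<noteq> \<beta>" "q \<in> \<alpha>" "q \<in> \<beta>"
      by (auto simp: crossing_points_def crossing_point_def)
    have "{x \<in> ?C. (case x of (\<alpha>, \<beta>, p) \<Rightarrow> \<lambda>q. q = p) q} \<subseteq> {(\<alpha>, \<beta>, q), (\<beta>, \<alpha>, q)}"
      using at_most_two[of q \<alpha> \<beta>] ab by (auto simp: incidences_def)
    then have "card {x \<in> ?C. (case x of (\<alpha>, \<beta>, p) \<Rightarrow> \<lambda>q. q = p) q} \<le> card {(\<alpha>, \<beta>, q), (\<beta>, \<alpha>, q)}"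
      by (intro card_mono) auto
    also have "\<dots> \<le> 2" by (rule card_doubleton_le)
    finally show "card {x \<in> ?C. (case x of (\<alpha>, \<beta>, p) \<Rightarrow> \<lambda>q. q = p) q} \<le> 2" .
  qed (use finC finite_crossing_points in auto)
  moreover have "card ?T * 1 \<le> card (touching_pairs S) * 2"
  proof (rule double_count[where R = "\<lambda>(\<alpha>, \<beta>, p) e. e = {\<alpha>, \<beta>}"])
    fix c assume c: "c \<in> ?T"
    then obtain \<alpha> \<beta> p where cc: "c = (\<alpha>, \<beta>, p)" "\<alpha> \<in> S" "\<beta> \<in> S" "\<alpha> \<noteq> \<beta>" "touching_point \<alpha> \<beta> p"
      by (auto simp: incidences_def)
    then have "{y \<in> touching_pairs S. (case c of (\<alpha>, \<beta>, p) \<Rightarrow> \<lambda>e. e = {\<alpha>, \<beta>}) y} = {{\<alpha>, \<beta>}}"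
      unfolding touching_pairs_def touch_def by auto
    then show "1 \<le> card {y \<in> touching_pairs S. (case c of (\<alpha>, \<beta>, p) \<Rightarrow> \<lambda>e. e = {\<alpha>, \<beta>}) y}" by simp
  next
    fix e assume "e \<in> touching_pairs S"
    then obtain \<alpha> \<beta> p where ab: "e = {\<alpha>, \<beta>}" "\<alpha> \<noteq> \<beta>" "\<alpha> \<inter> \<beta> = {p}"
      by (auto simp: touching_pairs_def touch_def touching_point_def)
    have "{x \<in> ?T. (case x of (\<alpha>, \<beta>, p) \<Rightarrow> \<lambda>e. e = {\<alpha>, \<beta>}) e} \<subseteq> {(\<alpha>, \<beta>, p), (\<beta>, \<alpha>, p)}"
    proof
      fix x assume x: "x \<in> {x \<in> ?T. (case x of (\<alpha>, \<beta>, p) \<Rightarrow> \<lambda>e. e = {\<alpha>, \<beta>}) e}"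
      obtain \<alpha>' \<beta>' p' where xx: "x = (\<alpha>', \<beta>', p')" by (cases x)
      have x': "{\<alpha>, \<beta>} = {\<alpha>', \<beta>'}" "p' \<in> \<alpha>' \<inter> \<beta>'" using x ab(1) by (simp_all add: xx incidences_def)
      from x'(1) consider "\<alpha>' = \<alpha>" "\<beta>' = \<beta>" | "\<alpha>' = \<beta>" "\<beta>' = \<alpha>"
        unfolding doubleton_eq_iff by blast
      then show "x \<in> {(\<alpha>, \<beta>, p), (\<beta>, \<alpha>, p)}"
      proof cases
        case 1
        then show ?thesis using x'(2) ab(3) by (simp add: xx)
      next
        case 2
        then show ?thesis using x'(2) ab(3) by (simp add: xx Int_commute)
      qed
    qed
    then have "card {x \<in> ?T. (case x of (\<alpha>, \<beta>, p) \<Rightarrow> \<lambda>e. e = {\<alpha>, \<beta>}) e} \<le> card {(\<alpha>, \<beta>, p), (\<beta>, \<alpha>, p)}"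
      by (intro card_mono) auto
    also have "\<dots> \<le> 2" by (rule card_doubleton_le)
    finally show "card {x \<in> ?T. (case x of (\<alpha>, \<beta>, p) \<Rightarrow> \<lambda>e. e = {\<alpha>, \<beta>}) e} \<le> 2" .
  next
    show "finite (touching_pairs S)"
      by (rule finite_subset[of _ "Pow S"]) (auto simp: touching_pairs_def finite_S)
  qed (use finT in auto)
  moreover have "incidences \<subseteq> ?C \<union> ?T" by (auto simp: crossing_point_def incidences_def)
  then have "card incidences \<le> card ?C + card ?T"
    using card_mono[OF _ \<open>incidences \<subseteq> ?C \<union> ?T\<close>] card_Un_le[of ?C ?T] finC finT by fastforce
  ultimately show ?thesis by linarith
qed

text \<open>Every curve contributes two vertices: \<open>(\<gamma>, True)\<close> stands for its \<open>i\<close>-th arc used as an upper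
  curve, \<open>(\<gamma>, False)\<close> for its \<open>j\<close>-th arc used as a lower curve. The abscissae of the arc ends are
  added to the crossings, since an arc may end before it reaches the crossing forced on it.\<close>

definition adjacent :: "nat \<Rightarrow> nat \<Rightarrow> complex set \<times> bool \<Rightarrow> complex set \<times> bool \<Rightarrow> bool" where
  "adjacent i j u v \<longleftrightarrow> (snd u \<and> \<not> snd v \<and> (fst u, fst v) \<in> edges i j) \<or>
     (\<not> snd u \<and> snd v \<and> (fst v, fst u) \<in> edges i j)"

definition touch_time :: "complex set \<times> bool \<Rightarrow> complex set \<times> bool \<Rightarrow> real" where
  "touch_time u v = Re (THE p. p \<in> fst u \<inter> fst v)"

definition arc_index :: "nat \<Rightarrow> nat \<Rightarrow> bool \<Rightarrow> nat" where
  "arc_index i j b = (if b then i else j)"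

definition events :: "nat \<Rightarrow> nat \<Rightarrow> complex set \<times> bool \<Rightarrow> complex set \<times> bool \<Rightarrow> real set" where
  "events i j u v = (if fst u \<in> S \<and> fst v \<in> S \<and> fst u \<noteq> fst v \<and> snd u = snd v then
     Re ` (fst u \<inter> fst v) \<union>
     {L (fst u) (arc_index i j (snd u)), R (fst u) (arc_index i j (snd u)),
      L (fst v) (arc_index i j (snd v)), R (fst v) (arc_index i j (snd v))} else {})"

lemma touch_time_eq: "above \<alpha> \<beta> i j p \<Longrightarrow> touch_time (\<alpha>, b) (\<beta>, c) = Re p"
  by (simp add: touch_time_def above_def)

lemma touch_time_sym: "touch_time u v = touch_time v u"
  by (simp add: touch_time_def Int_commute)

text \<open>Where \<beta> touches \<alpha>, the curve \<beta>' lies strictly below \<alpha> if its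
  arc is present there, and conversely. So the two arcs change order between the two abscissae, or
  one of them ends.\<close>

lemma common_upper_event:
  assumes "above \<alpha> \<beta> i j p" "above \<alpha> \<beta>' i j p'" "Re p < Re p'" "j < k"
  shows "\<exists>s\<in>events i j (\<beta>, False) (\<beta>', False). Re p < s \<and> s < Re p'"
proof -
  note a = aboveD[OF assms(1)] aboveD[OF assms(2)]
  have ne: "\<beta> \<noteq> \<beta>'" using a(4,16) assms(3) by auto
  have c: "continuous_on {L \<beta> j..R \<beta> j} (F \<beta> j)" "continuous_on {L \<beta>' j..R \<beta>' j} (F \<beta>' j)"
    using F_cont a assms(4) by auto
  have b: "L \<beta> j < Re p" "Re p < R \<beta> j" "L \<beta>' j < Re p'" "Re p' < R \<beta>' j" using a by auto
  have r: "Re p \<in> {L \<alpha> i..R \<alpha> i}" "Re p' \<in> {L \<alpha> i..R \<alpha> i}" using a(7,8,19,20) by auto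
  have d: "Re p \<in> {L \<beta>' j..R \<beta>' j} \<Longrightarrow> F \<beta>' j (Re p) < F \<beta> j (Re p)"
    "Re p' \<in> {L \<beta> j..R \<beta> j} \<Longrightarrow> F \<beta> j (Re p') < F \<beta>' j (Re p')"
    using above_less[OF assms(2) r(1)] above_less[OF assms(1) r(2)] a(12,24) assms(3) by auto
  obtain s where s: "Re p < s" "s < Re p'"
    "s = R \<beta> j \<or> s = L \<beta>' j \<or> (s \<in> {L \<beta> j..R \<beta> j} \<and> s \<in> {L \<beta>' j..R \<beta>' j} \<and> F \<beta> j s = F \<beta>' j s)"
    by (rule graphs_meet_between[OF c assms(3) b d])
  have "s \<in> Re ` (\<beta> \<inter> \<beta>')" if "s \<in> {L \<beta> j..R \<beta> j}" "s \<in> {L \<beta>' j..R \<beta>' j}" "F \<beta> j s = F \<beta>' j s"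
    using graph_mem[of \<beta> j s] graph_mem[of \<beta>' j s] that a assms(4)
    by (intro image_eqI[of _ _ "Complex s (F \<beta> j s)"]) auto
  then have "s \<in> events i j (\<beta>, False) (\<beta>', False)"
    using s(3) a ne by (auto simp: events_def arc_index_def)
  then show ?thesis using s by blast
qed

lemma common_lower_event:
  assumes "above \<alpha> \<beta> i j p" "above \<alpha>' \<beta> i j p'" "Re p < Re p'" "i < k"
  shows "\<exists>s\<in>events i j (\<alpha>, True) (\<alpha>', True). Re p < s \<and> s < Re p'"
proof -
  note a = aboveD[OF assms(1)] aboveD[OF assms(2)]
  have ne: "\<alpha> \<noteq> \<alpha>'" using a(4,16) assms(3) by auto
  \<comment> \<open>Negating the functions reflects the picture and reduces it to the orientation of
    \<open>graphs_meet_between\<close>.\<close>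
  have c: "continuous_on {L \<alpha> i..R \<alpha> i} (\<lambda>x. - F \<alpha> i x)" "continuous_on {L \<alpha>' i..R \<alpha>' i} (\<lambda>x. - F \<alpha>' i x)"
    using F_cont a assms(4) by (auto intro: continuous_on_minus)
  have b: "L \<alpha> i < Re p" "Re p < R \<alpha> i" "L \<alpha>' i < Re p'" "Re p' < R \<alpha>' i" using a by auto
  have r: "Re p \<in> {L \<beta> j..R \<beta> j}" "Re p' \<in> {L \<beta> j..R \<beta> j}" using a(9,10,21,22) by auto
  have d: "Re p \<in> {L \<alpha>' i..R \<alpha>' i} \<Longrightarrow> - F \<alpha>' i (Re p) < - F \<alpha> i (Re p)"
    "Re p' \<in> {L \<alpha> i..R \<alpha> i} \<Longrightarrow> - F \<alpha> i (Re p') < - F \<alpha>' i (Re p')"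
    using above_less[OF assms(2) _ r(1)] above_less[OF assms(1) _ r(2)] a(12,24) assms(3) by auto
  obtain s where s: "Re p < s" "s < Re p'"
    "s = R \<alpha> i \<or> s = L \<alpha>' i \<or> (s \<in> {L \<alpha> i..R \<alpha> i} \<and> s \<in> {L \<alpha>' i..R \<alpha>' i} \<and> - F \<alpha> i s = - F \<alpha>' i s)"
    by (rule graphs_meet_between[OF c assms(3) b d])
  have "s \<in> Re ` (\<alpha> \<inter> \<alpha>')" if "s \<in> {L \<alpha> i..R \<alpha> i}" "s \<in> {L \<alpha>' i..R \<alpha>' i}" "- F \<alpha> i s = - F \<alpha>' i s"
    using graph_mem[of \<alpha> i s] graph_mem[of \<alpha>' i s] that a assms(4)
    by (intro image_eqI[of _ _ "Complex s (F \<alpha> i s)"]) auto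
  then have "s \<in> events i j (\<alpha>, True) (\<alpha>', True)"
    using s(3) a ne by (auto simp: events_def arc_index_def)
  then show ?thesis using s by blast
qed

lemma adjacent_cases:
  assumes "adjacent i j u v"
  obtains \<alpha> \<beta> p where "u = (\<alpha>, True)" "v = (\<beta>, False)" "above \<alpha> \<beta> i j p" "touch_time u v = Re p"
  | \<alpha> \<beta> p where "u = (\<beta>, False)" "v = (\<alpha>, True)" "above \<alpha> \<beta> i j p" "touch_time u v = Re p"
proof -
  obtain \<alpha> b \<beta> c where uv: "u = (\<alpha>, b)" "v = (\<beta>, c)" by (metis prod.exhaust)
  from assms consider "b" "\<not> c" "(\<alpha>, \<beta>) \<in> edges i j" | "\<not> b" "c" "(\<beta>, \<alpha>) \<in> edges i j"
    unfolding adjacent_def uv by auto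
  then show thesis
  proof cases
    case 1
    then obtain p where "above \<alpha> \<beta> i j p" by (auto simp: edges_def)
    then show thesis using that(1)[of \<alpha> \<beta> p] touch_time_eq 1 uv by simp
  next
    case 2
    then obtain p where "above \<beta> \<alpha> i j p" by (auto simp: edges_def)
    then show thesis using that(2)[of \<alpha> \<beta> p] touch_time_eq touch_time_sym[of u v] 2 uv by simp
  qed
qed

text \<open>Adjacent vertices carry opposite flags, so two neighbours of a vertex carry equal flags
  and touch it from the same side.\<close>

lemma touch_system_of_curves:
  assumes "i < k" "j < k"
  shows "touch_system (S \<times> UNIV) (adjacent i j) touch_time (events i j)"
proof
  show "finite (S \<times> (UNIV :: bool set))" using finite_S by simp
  show "u \<in> S \<times> UNIV" if "adjacent i j u v" for u v
    using that by (cases u) (auto simp: adjacent_def edges_def above_def)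
  show "adjacent i j v u" if "adjacent i j u v" for u v using that by (auto simp: adjacent_def)
  show "touch_time u v = touch_time v u" for u v by (rule touch_time_sym)
  show "events i j u v = events i j v u" for u v
    unfolding events_def Int_commute[of "fst u" "fst v"] by (rule if_cong) (blast, blast, rule refl)
  show "finite (events i j u v)" for u v by (auto simp: events_def finite_Int)
  show "v = w" if "adjacent i j u v" "adjacent i j u w" "touch_time u v = touch_time u w" for u v w
    using that(1)
  proof (cases rule: adjacent_cases)
    case (1 \<alpha> \<beta> p)
    from that(2) 1 obtain \<beta>' p' where w: "w = (\<beta>', False)" "above \<alpha> \<beta>' i j p'" "touch_time u w = Re p'"
      by (cases rule: adjacent_cases) auto
    have "p = p'" using aboveD(11)[OF 1(3)] aboveD(11)[OF w(2)] aboveD(12)[OF 1(3)] aboveD(12)[OF w(2)] 1(4) w(3) that(3) by (simp add: complex_eq_iff)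
    then have "\<beta>' = \<beta>" using at_most_two[of p \<alpha> \<beta> \<beta>'] aboveD[OF 1(3)] aboveD[OF w(2)] by auto
    then show ?thesis using 1 w by simp
  next
    case (2 \<alpha> \<beta> p)
    from that(2) 2 obtain \<alpha>' p' where w: "w = (\<alpha>', True)" "above \<alpha>' \<beta> i j p'" "touch_time u w = Re p'"
      by (cases rule: adjacent_cases) auto
    have "p = p'" using aboveD(11)[OF 2(3)] aboveD(11)[OF w(2)] aboveD(12)[OF 2(3)] aboveD(12)[OF w(2)] 2(4) w(3) that(3) by (simp add: complex_eq_iff)
    then have "\<alpha>' = \<alpha>" using at_most_two[of p \<beta> \<alpha> \<alpha>'] aboveD[OF 2(3)] aboveD[OF w(2)] by auto
    then show ?thesis using 2 w by simp
  qed
  show "\<exists>s\<in>events i j v w. touch_time u v < s \<and> s < touch_time u w"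
    if "adjacent i j u v" "adjacent i j u w" "touch_time u v < touch_time u w" for u v w
    using that(1)
  proof (cases rule: adjacent_cases)
    case (1 \<alpha> \<beta> p)
    from that(2) 1 obtain \<beta>' p' where w: "w = (\<beta>', False)" "above \<alpha> \<beta>' i j p'" "touch_time u w = Re p'"
      by (cases rule: adjacent_cases) auto
    show ?thesis using common_upper_event[OF 1(3) w(2) _ assms(2)] 1 w that(3) by simp
  next
    case (2 \<alpha> \<beta> p)
    from that(2) 2 obtain \<alpha>' p' where w: "w = (\<alpha>', True)" "above \<alpha>' \<beta> i j p'" "touch_time u w = Re p'"
      by (cases rule: adjacent_cases) auto
    show ?thesis using common_lower_event[OF 2(3) w(2) _ assms(1)] 2 w that(3) by simp
  qed
qed

text \<open>Every incidence appears once per flag. The term \<open>8 * (card S)^2\<close> pays for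
  the added arc ends: ordered pairs of curves, times flag, times which curve, times which
  end.\<close>

lemma crossings_of_curves:
  assumes "i < k" "j < k"
  shows "card (touch_system.crossings (S \<times> UNIV) (events i j))
    \<le> 4 * card (crossing_points S) + 4 * card (touching_pairs S) + 8 * (card S)\<^sup>2"
proof -
  let ?g1 = "\<lambda>((\<alpha>, \<beta>, p), b :: bool). ((\<alpha>, b), (\<beta>, b), Re p)"
  define g2 where "g2 = (\<lambda>(\<alpha>, \<beta>, b, c, d). ((\<alpha>, b :: bool), (\<beta>, b),
     (if d then L else R) (if c then \<alpha> else \<beta>) (arc_index i j b)))"
  let ?Y = "S \<times> S \<times> (UNIV :: bool set) \<times> (UNIV :: bool set) \<times> (UNIV :: bool set)"
  have "touch_system.crossings (S \<times> UNIV) (events i j) \<subseteq> ?g1 ` (incidences \<times> UNIV) \<union> g2 ` ?Y"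
  proof
    fix y assume "y \<in> touch_system.crossings (S \<times> UNIV) (events i j)"
    moreover obtain u v s where "y = (u, v, s)" by (cases y)
    ultimately have y: "y = (u, v, s)" "s \<in> events i j u v"
      by (simp_all add: touch_system.crossings_def[OF touch_system_of_curves[OF assms]])
    obtain \<alpha> b \<beta> c where uv: "u = (\<alpha>, b)" "v = (\<beta>, c)" by (metis prod.exhaust)
    have ab: "\<alpha> \<in> S" "\<beta> \<in> S" "\<alpha> \<noteq> \<beta>" "c = b" and s: "s \<in> Re ` (\<alpha> \<inter> \<beta>) \<union>
        {L \<alpha> (arc_index i j b), R \<alpha> (arc_index i j b), L \<beta> (arc_index i j b), R \<beta> (arc_index i j b)}"
      using y(2) by (auto simp: events_def uv split: if_splits)
    show "y \<in> ?g1 ` (incidences \<times> UNIV) \<union> g2 ` ?Y"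
    proof (cases "s \<in> Re ` (\<alpha> \<inter> \<beta>)")
      case True
      then obtain p where "p \<in> \<alpha> \<inter> \<beta>" "s = Re p" by auto
      then have "y = ?g1 ((\<alpha>, \<beta>, p), b)" "((\<alpha>, \<beta>, p), b) \<in> incidences \<times> UNIV"
        using ab by (auto simp: y uv incidences_def)
      then show ?thesis by blast
    next
      case False
      then have "\<exists>d e. s = (if d then L else R) (if e then \<alpha> else \<beta>) (arc_index i j b)"
      proof -
        let ?a = "arc_index i j b"
        have "s = L \<alpha> ?a \<or> s = R \<alpha> ?a \<or> s = L \<beta> ?a \<or> s = R \<beta> ?a" using s False by blast
        then show ?thesis
          by (elim disjE) (rule exI[of _ True], rule exI[of _ True], simp, rule exI[of _ False], rule exI[of _ True], simp,
              rule exI[of _ True], rule exI[of _ False], simp, rule exI[of _ False], rule exI[of _ False], simp)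
      qed
      then obtain d e where "s = (if d then L else R) (if e then \<alpha> else \<beta>) (arc_index i j b)" by blast
      then have "y = g2 (\<alpha>, \<beta>, b, e, d)" using ab by (simp add: y uv g2_def)
      then show ?thesis using ab by blast
    qed
  qed
  then have "card (touch_system.crossings (S \<times> UNIV) (events i j)) \<le>
      card (?g1 ` (incidences \<times> UNIV) \<union> g2 ` ?Y)"
    by (rule card_mono[rotated]) (auto simp: finite_S)
  also have "\<dots> \<le> card (?g1 ` (incidences \<times> UNIV)) + card (g2 ` ?Y)" by (rule card_Un_le)
  also have "\<dots> \<le> card (incidences \<times> (UNIV :: bool set)) + card ?Y"
    by (intro add_mono card_image_le) (auto simp: finite_S)
  also have "\<dots> = 2 * card incidences + 8 * (card S)\<^sup>2"
    by (simp add: card_cartesian_product power2_eq_square)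
  finally show ?thesis using card_incidences by simp
qed

lemma crossing_points_lower_bound:
  fixes K :: nat
  assumes K: "K \<ge> 1" and k: "0 < k" and T: "2 * k * card S < card (touching_pairs S)"
    and big: "k\<^sup>2 * (2 * card S * (30000000000 * K ^ 4) ^ (101 * K\<^sup>2)) + 2 * k * card S \<le> card (touching_pairs S)"
  shows "K * card (touching_pairs S) \<le> K * (2 * k * card S) +
    k\<^sup>2 * (4 * card (crossing_points S) + 4 * card (touching_pairs S) + 8 * (card S)\<^sup>2)"
proof -
  obtain i j where ij: "i < k" "j < k"
    and E: "card (touching_pairs S) \<le> 2 * k * card S + k\<^sup>2 * card (edges i j)"
    using many_edges[OF k] .
  interpret touch_system "S \<times> UNIV" "adjacent i j" touch_time "events i j"
    by (rule touch_system_of_curves[OF ij])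
  have "card (edges i j) \<le> card darts"
  proof (rule card_inj_on_le[where f = "\<lambda>(\<alpha>, \<beta>). ((\<alpha>, True), (\<beta>, False))"])
    show "inj_on (\<lambda>(\<alpha>, \<beta>). ((\<alpha>, True), (\<beta>, False))) (edges i j)" by (auto intro: inj_onI)
    show "(\<lambda>(\<alpha>, \<beta>). ((\<alpha>, True), (\<beta>, False))) ` edges i j \<subseteq> darts"
      by (auto simp: darts_def adjacent_def)
  qed simp
  then have ED: "k\<^sup>2 * card (edges i j) \<le> k\<^sup>2 * card darts" by simp
  have "k\<^sup>2 * (2 * card S * (30000000000 * K ^ 4) ^ (101 * K\<^sup>2)) \<le> k\<^sup>2 * card darts"
    using big E ED by linarith
  then have "2 * card S * (30000000000 * K ^ 4) ^ (101 * K\<^sup>2) \<le> card darts"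
    using k by simp
  moreover have "card (S \<times> (UNIV :: bool set)) = 2 * card S" by (simp add: card_cartesian_product)
  moreover have "darts \<noteq> {}" using T E ED by auto
  ultimately have "K * card darts < card crossings" using many_crossings[OF K] by simp
  then have "k\<^sup>2 * (K * card darts) \<le> k\<^sup>2 * card crossings" by simp
  also have "\<dots> \<le> k\<^sup>2 * (4 * card (crossing_points S) + 4 * card (touching_pairs S) + 8 * (card S)\<^sup>2)"
    using crossings_of_curves[OF ij] by (rule mult_le_mono2)
  finally have *: "K * (k\<^sup>2 * card darts) \<le> \<dots>" by (simp only: mult_ac)
  have "K * card (touching_pairs S) \<le> K * (2 * k * card S + k\<^sup>2 * card darts)"
    using E ED by (intro mult_le_mono2) linarith
  also have "\<dots> = K * (2 * k * card S) + K * (k\<^sup>2 * card darts)" by (rule distrib_left)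
  finally show ?thesis using * by linarith
qed

end

section \<open>From the geometric hypotheses to the asymptotic bound\<close>

lemma x_monotone_decomposable_graphs:
  assumes "x_monotone_decomposable k \<gamma>"
  shows "\<exists>l r F. (\<forall>i<k. continuous_on {l i..r i} (F i)) \<and>
    \<gamma> = (\<Union>i<k. (\<lambda>x. Complex x (F i x)) ` {l i..r i})"
proof -
  obtain a where a: "\<forall>i<k. x_monotone_arc (a i)" "\<gamma> = (\<Union>i<k. a i)"
    using assms by (auto simp: x_monotone_decomposable_def)
  have "\<exists>l r F. i < k \<longrightarrow> continuous_on {l..r} F \<and> a i = (\<lambda>x. Complex x (F x)) ` {l..r}" for i
    using a(1) x_monotone_arc_graph[of "a i"] by metis
  then obtain l r F where "\<And>i. i < k \<Longrightarrow> continuous_on {l i..r i} (F i) \<and>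
      a i = (\<lambda>x. Complex x (F i x)) ` {l i..r i}"
    by metis
  then show ?thesis using a(2) by (intro exI[of _ l] exI[of _ r] exI[of _ F]) auto
qed

lemma curve_family_exists:
  assumes "finite S" "\<forall>\<gamma>\<in>S. closed_curve \<gamma>" "general_position S" "\<forall>\<gamma>\<in>S. x_monotone_decomposable k \<gamma>"
  obtains L R F where "curve_family S k L R F"
proof -
  have "\<forall>\<gamma>\<in>S. \<exists>q. (\<forall>i<k. continuous_on {fst q i..fst (snd q) i} (snd (snd q) i)) \<and>
      \<gamma> = (\<Union>i<k. (\<lambda>x. Complex x (snd (snd q) i x)) ` {fst q i..fst (snd q) i})"
  proof
    fix \<gamma> assume "\<gamma> \<in> S"
    then have "x_monotone_decomposable k \<gamma>" using assms(4) by blast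
    from x_monotone_decomposable_graphs[OF this] obtain l r F where "(\<forall>i<k. continuous_on {l i..r i} (F i)) \<and>
      \<gamma> = (\<Union>i<k. (\<lambda>x. Complex x (F i x)) ` {l i..r i})"
      by (elim exE)
    then show "\<exists>q. (\<forall>i<k. continuous_on {fst q i..fst (snd q) i} (snd (snd q) i)) \<and>
      \<gamma> = (\<Union>i<k. (\<lambda>x. Complex x (snd (snd q) i x)) ` {fst q i..fst (snd q) i})"
      by (intro exI[of _ "(l, r, F)"]) (unfold fst_conv snd_conv)
  qed
  from bchoice[OF this] obtain q where q: "\<forall>\<gamma>\<in>S. (\<forall>i<k. continuous_on
      {fst (q \<gamma>) i..fst (snd (q \<gamma>)) i} (snd (snd (q \<gamma>)) i)) \<and>
      \<gamma> = (\<Union>i<k. (\<lambda>x. Complex x (snd (snd (q \<gamma>)) i x)) ` {fst (q \<gamma>) i..fst (snd (q \<gamma>)) i})"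
    by (elim exE)
  note q1 = conjunct1[OF bspec[OF q], rule_format] and q2 = conjunct2[OF bspec[OF q]]
  have "curve_family S k (\<lambda>\<gamma>. fst (q \<gamma>)) (\<lambda>\<gamma>. fst (snd (q \<gamma>))) (\<lambda>\<gamma>. snd (snd (q \<gamma>)))"
    by unfold_locales (use assms(1-3) in blast, use assms(1-3) in blast, rule assms(3), erule (1) q1, erule q2)
  then show thesis by (rule that)
qed

lemma card_touching_pairs_le:
  assumes "finite S"
  shows "card (touching_pairs S) \<le> (card S)\<^sup>2"
proof -
  have "touching_pairs S \<subseteq> (\<lambda>(\<alpha>, \<beta>). {\<alpha>, \<beta>}) ` (S \<times> S)"
    by (auto simp: touching_pairs_def)
  then have "card (touching_pairs S) \<le> card (S \<times> S)"
    using assms by (intro surj_card_le) auto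
  then show ?thesis by (simp add: card_cartesian_product power2_eq_square)
qed

text \<open>With \<open>y = ln n\<close>, the logarithm of the power is at most
  \<open>101 * (y / ln y) / 900 * (4 * ln y)\<close>, less than \<open>y / 2\<close>; the root is at
  most \<open>exp (y / 2)\<close>. The bound \<open>200000\<close> is there because its square
  exceeds \<open>30000000000\<close>, so one step of the scale costs at most
  \<open>y ^ 4\<close>.\<close>

lemma depth_power_le:
  fixes n K :: nat
  assumes y: "200000 \<le> ln (real n)" and n: "n > 0" and K: "1 \<le> K"
    and Ky: "real K \<le> sqrt (ln (real n) / ln (ln (real n))) / 30"
  shows "real ((30000000000 * K ^ 4) ^ (101 * K\<^sup>2)) * sqrt (ln (real n) / ln (ln (real n))) \<le> real n"
proof -
  define y where "y = ln (real n)"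
  define L where "L = y / ln y"
  have y0: "y \<ge> 200000" using assms by (simp add: y_def)
  have "exp 1 \<le> y" using exp_le y0 by linarith
  then have ly: "ln y \<ge> 1" using y0 ln_ge_iff[of y 1] by simp
  have L: "0 < L" "L \<le> y" using ly y0 by (auto simp: L_def field_simps)
  have KL: "(real K)\<^sup>2 \<le> L / 900"
  proof -
    have "(real K)\<^sup>2 \<le> (sqrt L / 30)\<^sup>2" using Ky by (intro power_mono) (auto simp: L_def y_def)
    then show ?thesis using L by (simp add: power_divide)
  qed
  have r4: "30000000000 * real K ^ 4 \<le> y ^ 4"
  proof -
    have "real K ^ 4 = ((real K)\<^sup>2)\<^sup>2" by simp
    also have "\<dots> \<le> y\<^sup>2" using KL L y0 by (intro power_mono) auto
    finally have a: "real K ^ 4 \<le> y\<^sup>2" .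
    have "(200000::real)\<^sup>2 \<le> y\<^sup>2" using y0 by (intro power_mono) auto
    then have "30000000000 * real K ^ 4 \<le> y\<^sup>2 * y\<^sup>2" using a by (intro mult_mono) auto
    then show ?thesis by (simp add: power2_eq_square power4_eq_xxxx)
  qed
  have r1: "1 \<le> 30000000000 * real K ^ 4"
  proof -
    have "1 \<le> real K ^ 4" using K by (intro one_le_power) simp
    then show ?thesis by simp
  qed
  have "ln (30000000000 * real K ^ 4) \<le> ln (y ^ 4)" using r4 r1 by (intro ln_mono) linarith+
  also have "\<dots> = 4 * ln y" using y0 by (simp add: ln_realpow)
  finally have lr: "ln (30000000000 * real K ^ 4) \<le> 4 * ln y" .
  have "real ((30000000000 * K ^ 4) ^ (101 * K\<^sup>2)) = (30000000000 * real K ^ 4) ^ (101 * K\<^sup>2)" by simp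
  also have "\<dots> = exp (real (101 * K\<^sup>2) * ln (30000000000 * real K ^ 4))"
    using r1 by (subst exp_of_nat_mult) (subst exp_ln, linarith, rule refl)
  also have "\<dots> \<le> exp (y / 2)"
  proof -
    have "real (101 * K\<^sup>2) * ln (30000000000 * real K ^ 4) \<le> (101 * (L / 900)) * (4 * ln y)"
      using KL lr r1 ly L by (intro mult_mono) auto
    also have "\<dots> = 404 / 900 * y" using ly by (simp add: L_def)
    also have "\<dots> \<le> y / 2" using y0 by simp
    finally show ?thesis by simp
  qed
  finally have A: "real ((30000000000 * K ^ 4) ^ (101 * K\<^sup>2)) \<le> exp (y / 2)" .
  have B: "sqrt L \<le> exp (y / 2)"
  proof -
    have "L \<le> exp y" using L exp_ge_add_one_self[of y] by linarith
    then have "sqrt L \<le> sqrt (exp y)" by simp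
    also have "\<dots> = exp (y / 2)"
      by (rule real_sqrt_unique) (auto simp flip: exp_of_nat_mult)
    finally show ?thesis .
  qed
  have "real ((30000000000 * K ^ 4) ^ (101 * K\<^sup>2)) * sqrt L \<le> exp (y / 2) * exp (y / 2)"
    using A B L by (intro mult_mono) auto
  also have "\<dots> = exp y" by (simp flip: exp_add)
  also have "\<dots> = real n" using n by (simp add: y_def)
  finally show ?thesis by (simp add: L_def y_def)
qed

theorem theorem6:
  fixes k :: nat
  assumes "k > 0"
  shows "\<exists>C c :: real. C > 0 \<and> c > 0 \<and>
    (\<forall>(n::nat) (S :: complex set set) (\<epsilon>::real).
       n \<ge> 3 \<and>
       finite S \<and> card S = n \<and>
       (\<forall>\<gamma>\<in>S. closed_curve \<gamma>) \<and>
       general_position S \<and>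
       real (card (touching_pairs S)) \<ge> \<epsilon> * real n ^ 2 \<and>
       (\<forall>\<gamma>\<in>S. x_monotone_decomposable k \<gamma>) \<and>
       \<epsilon> > C * sqrt (ln (ln (real n)) / ln (real n))
       \<longrightarrow> real (card (crossing_points S))
             \<ge> c * \<epsilon> * real n ^ 2 * sqrt (ln (real n) / ln (ln (real n))))"
proof -
  have "exp 1 < (3::real)" using e_less_272 by simp
  then have "1 < ln (3::real)" using ln_less_cancel_iff[of "exp 1" 3] by simp
  then have l3: "0 < ln (ln (3::real))" by simp
  \<comment> \<open>The first summand absorbs the error terms, including the artificial arc ends;
    the second forces \<open>ln n\<close> to be at least \<open>200000\<close>.\<close>
  define C where "C = 3840 * (real k)\<^sup>2 + sqrt (200000 / ln (ln 3))"
  define c where "c = 1 / (1920 * (real k)\<^sup>2)"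
  have k1: "1 \<le> (real k)\<^sup>2" using assms by simp
  have "0 \<le> sqrt (200000 / ln (ln 3))" using l3 by simp
  then have C0: "C \<ge> 3840 * (real k)\<^sup>2" "C > 0" using k1 unfolding C_def by linarith+
  have c0: "c > 0" using assms by (simp add: c_def)
  have main: "c * \<epsilon> * real n ^ 2 * sqrt (ln (real n) / ln (ln (real n))) \<le> real (card (crossing_points S))"
    if n3: "n \<ge> 3" and fin: "finite S" and n: "card S = n" and cc: "\<forall>\<gamma>\<in>S. closed_curve \<gamma>"
      and gp: "general_position S" and T: "real (card (touching_pairs S)) \<ge> \<epsilon> * real n ^ 2"
      and dec: "\<forall>\<gamma>\<in>S. x_monotone_decomposable k \<gamma>"
      and eps: "\<epsilon> > C * sqrt (ln (ln (real n)) / ln (real n))"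
    for n :: nat and S :: "complex set set" and \<epsilon> :: real
  proof -
    define y where "y = ln (real n)"
    define s where "s = sqrt (y / ln y)"
    define t where "t = real (card (touching_pairs S))"
    define x where "x = real (card (crossing_points S))"
    have y3: "ln 3 \<le> y" using n3 by (simp add: y_def)
    have ly: "ln (ln 3) \<le> ln y" using y3 \<open>1 < ln 3\<close> by (intro ln_mono) auto
    have y0: "y > 0" and ly0: "ln y > 0" using y3 \<open>1 < ln 3\<close> ly l3 by auto
    have s0: "s > 0" using y0 ly0 by (simp add: s_def)
    have "sqrt (ln y / y) = 1 / s" by (simp add: s_def real_sqrt_divide)
    then have es: "C < \<epsilon> * s" using eps s0 by (simp add: y_def pos_divide_less_eq)
    have "\<epsilon> * real n ^ 2 \<le> 1 * real n ^ 2"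
    proof -
      have "real (card (touching_pairs S)) \<le> real (n\<^sup>2)"
        using card_touching_pairs_le[OF fin] unfolding n by (rule of_nat_mono)
      then show ?thesis using T unfolding of_nat_power by linarith
    qed
    \<comment> \<open>The trivial bound on the number of pairs gives \<epsilon> at most 1, so the
      assumption on \<epsilon> forces \<open>C < s\<close>, that is, \<open>n\<close> is
      large.\<close>
    then have e1: "\<epsilon> \<le> 1" using n3 by (subst (asm) mult_le_cancel_right) auto
    have e0: "\<epsilon> > 0" using es C0(2) s0 by (meson less_trans zero_less_mult_pos2)
    have "\<epsilon> * s \<le> 1 * s" using e1 s0 by (intro mult_right_mono) auto
    then have sC: "C < s" using es by linarith
    have big: "200000 \<le> y"
    proof (rule ccontr)
      assume "\<not> 200000 \<le> y"
      then have "y / ln y \<le> 200000 / ln (ln 3)" using ly l3 by (intro frac_le) auto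
      then have "s \<le> sqrt (200000 / ln (ln 3))" by (simp add: s_def)
      then show False using sC k1 by (simp add: C_def)
    qed
    define K where "K = nat \<lfloor>s / 30\<rfloor>"
    have s30: "128 * (real k)\<^sup>2 \<le> s / 30" using sC C0(1) by simp
    have Ks: "real K \<le> s / 30" and Ks': "s / 30 - 1 \<le> real K"
    proof -
      have "real K = real_of_int \<lfloor>s / 30\<rfloor>" using s0 by (simp add: K_def)
      then show "real K \<le> s / 30" "s / 30 - 1 \<le> real K" by linarith+
    qed
    have Kk: "16 * (real k)\<^sup>2 \<le> real K" using Ks' s30 k1 by linarith
    have "1 \<le> real K" using Kk k1 by linarith
    then have K1: "1 \<le> K" by simp
    have Ks2: "s / 60 \<le> real K" using Ks' s30 k1 by linarith
    define N where "N = (30000000000 * K ^ 4) ^ (101 * K\<^sup>2)"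
    have Nn: "real N * s \<le> real n"
      unfolding N_def s_def y_def
      by (rule depth_power_le) (use big Ks K1 n3 in \<open>auto simp: s_def y_def\<close>)
    have "0 < N" using K1 by (simp add: N_def)
    then have N1: "1 \<le> real N" by simp
    have T4: "4 * (real k)\<^sup>2 * real n * real N \<le> t"
    proof -
      have "4 * (real k)\<^sup>2 * real n * real N * s = 4 * (real k)\<^sup>2 * real n * (real N * s)" by simp
      also have "\<dots> \<le> 4 * (real k)\<^sup>2 * real n * real n" using Nn by (intro mult_left_mono) auto
      also have "\<dots> \<le> (\<epsilon> * s) * real n * real n"
        using es C0(1) k1 by (intro mult_right_mono) auto
      also have "\<dots> \<le> t * s" using T s0 by (simp add: t_def power2_eq_square mult.commute mult.left_commute)
      finally show ?thesis using s0 by simp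
    qed
    have nat_big: "k\<^sup>2 * (2 * card S * N) + 2 * k * card S \<le> card (touching_pairs S)"
    proof -
      have "real k \<le> (real k)\<^sup>2" using assms by (simp add: power2_eq_square)
      then have "real k * real n * 1 \<le> (real k)\<^sup>2 * real n * real N"
        using N1 by (intro mult_mono) auto
      then have "real (k\<^sup>2 * (2 * card S * N) + 2 * k * card S) \<le> real (card (touching_pairs S))"
        using T4 by (simp add: n t_def)
      then show ?thesis by (simp only: of_nat_le_iff)
    qed
    have kn: "4 * real k * real n \<le> t"
    proof -
      have "real k \<le> (real k)\<^sup>2" using assms by (simp add: power2_eq_square)
      then have "real k * real n * 1 \<le> (real k)\<^sup>2 * real n * real N"
        using N1 by (intro mult_mono) auto
      then show ?thesis using T4 by simp
    qed
    have "0 < 4 * real k * real n" using assms n3 by simp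
    then have "0 < t" using kn by linarith
    then have "2 * real k * real n < t" using kn by simp
    then have "real (2 * k * card S) < real (card (touching_pairs S))" by (simp add: n t_def)
    then have tk: "2 * k * card S < card (touching_pairs S)" by (simp only: of_nat_less_iff)
    obtain L R F where "curve_family S k L R F"
      using curve_family_exists[OF fin cc gp dec] .
    then interpret curve_family S k L R F .
    have "real (K * card (touching_pairs S)) \<le> real (K * (2 * k * card S) +
      k\<^sup>2 * (4 * card (crossing_points S) + 4 * card (touching_pairs S) + 8 * (card S)\<^sup>2))"
      using crossing_points_lower_bound[OF K1 assms tk nat_big[unfolded N_def]] by (rule of_nat_mono)
    then have "real K * t \<le> real K * (2 * real k * real n) + (real k)\<^sup>2 * (4 * x + 4 * t + 8 * (real n)\<^sup>2)"
      by (simp add: t_def x_def n)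
    moreover have "real K * (2 * real k * real n) \<le> real K * (t / 2)"
      using kn by (intro mult_left_mono) auto
    ultimately have "real K * t / 2 \<le> (real k)\<^sup>2 * (4 * x + 4 * t + 8 * (real n)\<^sup>2)" by simp
    \<comment> \<open>Touchings counted as crossings are absorbed on the left, as \<open>K\<close>
      is at least \<open>16 * k^2\<close>.\<close>
    moreover have "(real k)\<^sup>2 * (4 * t) \<le> real K * t / 4"
      using mult_right_mono[OF Kk, of t] \<open>0 < t\<close> by simp
    ultimately have A: "real K * t / 4 \<le> (real k)\<^sup>2 * (4 * x + 8 * (real n)\<^sup>2)"
      by (simp add: distrib_left)
    have "(s / 60) * (\<epsilon> * (real n)\<^sup>2) \<le> real K * t"
      using Ks2 T e0 s0 by (intro mult_mono) (auto simp: t_def)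
    then have B: "\<epsilon> * s * (real n)\<^sup>2 / 240 \<le> (real k)\<^sup>2 * (4 * x) + 8 * ((real k)\<^sup>2 * (real n)\<^sup>2)"
      using A by (simp add: distrib_left mult_ac)
    \<comment> \<open>The arc-end term is at most half of the left side of \<open>B\<close>, as
      \<open>3840 = 8 * 480\<close>; then \<open>1920 = 4 * 480\<close> gives
      \<open>c\<close>.\<close>
    have "3840 * (real k)\<^sup>2 * (real n)\<^sup>2 \<le> \<epsilon> * s * (real n)\<^sup>2"
      using es C0(1) by (intro mult_right_mono) auto
    then have "\<epsilon> * s * (real n)\<^sup>2 / 480 \<le> (real k)\<^sup>2 * (4 * x)" using B by linarith
    then have "\<epsilon> * s * (real n)\<^sup>2 / (1920 * (real k)\<^sup>2) \<le> x"
      using assms by (simp add: field_simps)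
    then show ?thesis by (simp add: c_def x_def s_def y_def mult_ac)
  qed
  show ?thesis
    by (intro exI[of _ C] exI[of _ c] conjI allI impI C0(2) c0, elim conjE) (rule main; assumption)
qed

end
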